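(* Let $K$ be an algebraically closed field of characteristic zero, and for positive integers $d,r$ let $S_{d,r}\subset\mathbb{P}(K[u,v]_d)$ be the set of (classes of) binary forms of degree $d$ and Waring rank exactly $r$. Let $d$ be a positive integer, let $k$ be an integer, and suppose that $d\ge d-k>\left\lceil \frac{d+1}{2}\right\rceil$. Then $$\overline{S_{d,d-k}}=\left(\bigcup_{i=1}^{k+1}S_{d,i}\right)\cup\left(\bigcup_{i=0}^{k}S_{d,d-i}\right),$$ where the bar denotes Zariski closure in $\mathbb{P}(K[u,v]_d)$. In particular, $$\overline{S_{d,d-k}}\setminus\overline{S_{d,d-k+1}}=S_{d,k+1}\cup S_{d,d-k}.$$
   Context: $K[u,v]_d$ is the vector space of binary forms (homogeneous polynomials in two variables) of degree $d$ over $K$, and $\mathbb{P}(K[u,v]_d)\cong\mathbb{P}^d$ is its projectivization. The Waring rank of a nonzero form $f\in K[u,v]_d$ is the smallest integer $r$ such that $f=l_1^d+\dots+l_r^d$ for some linear forms $l_1,\dots,l_r\in K[u,v]_1$. It depends only on the class of $f$ up to nonzero scalars. By convention $\overline{S_{d,d+1}}=\emptyset$ (no binary form of degree $d$ has rank $d+1$). *)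

theory Defs
  imports
    "HOL-Analysis.Analysis"
    "HOL-Computational_Algebra.Computational_Algebra"
    "HOL-Library.Poly_Mapping"
begin

section \<open>Binary forms and Waring rank\<close>

text \<open>
  The ring \<open>K[u,v]\<close> is represented as \<open>K[u][v]\<close>: the coefficient of \<open>u ^ i * v ^ j\<close> in \<open>f\<close> is
  \<open>coeff (coeff f j) i\<close>. The set below is the vector space \<open>K[u,v]\<^sub>d\<close>; it contains \<open>0\<close>.
\<close>

definition binary_forms :: "nat \<Rightarrow> 'a::field poly poly set" where
  "binary_forms d = {f. \<forall>i j. coeff (coeff f j) i \<noteq> 0 \<longrightarrow> i + j = d}"

text \<open>
  Over an algebraically closed field of characteristic zero every form of degree \<open>d \<ge> 1\<close> is a sum
  of \<open>d\<close>-th powers of linear forms, so that the minimum exists.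
\<close>

definition waring_rank :: "nat \<Rightarrow> 'a::field poly poly \<Rightarrow> nat" where
  "waring_rank d f =
     (LEAST r. \<exists>l. (\<forall>i<r. l i \<in> binary_forms 1) \<and> f = (\<Sum>i<r. l i ^ d))"


section \<open>The projective space of binary forms\<close>

definition proportional :: "nat \<Rightarrow> ('a::field poly poly \<times> 'a poly poly) set" where
  "proportional d = {(f, g). f \<in> binary_forms d - {0} \<and> g \<in> binary_forms d - {0} \<and>
     (\<exists>c. c \<noteq> 0 \<and> g = smult [:c:] f)}"

definition proj_forms :: "nat \<Rightarrow> 'a::field poly poly set set" where
  "proj_forms d = (binary_forms d - {0}) // proportional d"

definition waring_stratum :: "nat \<Rightarrow> int \<Rightarrow> 'a::field poly poly set set" where
  "waring_stratum d r =
     {proportional d `` {f} | f. f \<in> binary_forms d \<and> f \<noteq> 0 \<and> int (waring_rank d f) = r}"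

lemma binary_forms_smult:
  "f \<in> binary_forms d \<Longrightarrow> smult [:c:] f \<in> binary_forms d"
  by (auto simp: binary_forms_def)

lemma equiv_proportional: "equiv (binary_forms d - {0} :: 'a::field poly poly set) (proportional d)"
  (is "equiv ?A ?R")
proof (rule equivI)
  show "?R \<subseteq> ?A \<times> ?A"
    by (auto simp: proportional_def)
  show "refl_on ?A ?R"
    by (auto simp: refl_on_def proportional_def intro!: exI[of _ 1] simp flip: one_pCons)
  show "sym ?R"
  proof (rule symI)
    fix f g :: "'a poly poly"
    assume fg: "(f, g) \<in> proportional d"
    then obtain c where c: "c \<noteq> 0" "g = smult [:c:] f"
      by (auto simp: proportional_def)
    have "f = smult [:inverse c:] g"
      using c by (simp flip: one_pCons)
    then show "(g, f) \<in> proportional d"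
      using fg c(1) unfolding proportional_def by (auto intro!: exI[of _ "inverse c"])
  qed
  show "trans ?R"
  proof (rule transI)
    fix f g h :: "'a poly poly"
    assume fg: "(f, g) \<in> proportional d" and gh: "(g, h) \<in> proportional d"
    obtain a where a: "a \<noteq> 0" "g = smult [:a:] f"
      using fg by (auto simp: proportional_def)
    obtain b where b: "b \<noteq> 0" "h = smult [:b:] g"
      using gh by (auto simp: proportional_def)
    have "h = smult [:b * a:] f" "b * a \<noteq> 0"
      using a b by (simp_all add: mult.commute)
    then show "(f, h) \<in> proportional d"
      using fg gh unfolding proportional_def mem_Collect_eq case_prod_conv by blast
  qed
qed


section \<open>The Zariski topology\<close>

text \<open>
  Multivariate polynomials in variables indexed by natural numbers are finitely supported maps
  from monomials (finitely supported exponent vectors) to coefficients.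
\<close>

type_synonym 'a mpolynomial = "(nat \<Rightarrow>\<^sub>0 nat) \<Rightarrow>\<^sub>0 'a"

definition monom_degree :: "(nat \<Rightarrow>\<^sub>0 nat) \<Rightarrow> nat" where
  "monom_degree m = (\<Sum>i\<in>Poly_Mapping.keys m. Poly_Mapping.lookup m i)"

definition monom_eval :: "(nat \<Rightarrow>\<^sub>0 nat) \<Rightarrow> (nat \<Rightarrow> 'a::field) \<Rightarrow> 'a" where
  "monom_eval m x = (\<Prod>i\<in>Poly_Mapping.keys m. x i ^ Poly_Mapping.lookup m i)"

definition mpoly_eval :: "'a::field mpolynomial \<Rightarrow> (nat \<Rightarrow> 'a) \<Rightarrow> 'a" where
  "mpoly_eval P x = (\<Sum>m\<in>Poly_Mapping.keys P. Poly_Mapping.lookup P m * monom_eval m x)"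

text \<open>The homogeneous polynomials, of any degree, in the variables \<open>x\<^sub>0, \<dots>, x\<^sub>d\<close>.\<close>

definition homogeneous_polys :: "nat \<Rightarrow> 'a::field mpolynomial set" where
  "homogeneous_polys d = {P. (\<forall>m\<in>Poly_Mapping.keys P. Poly_Mapping.keys m \<subseteq> {..d}) \<and>
     (\<exists>e. \<forall>m\<in>Poly_Mapping.keys P. monom_degree m = e)}"

text \<open>The form \<open>\<Sum>i\<le>d. a\<^sub>i * u ^ (d - i) * v ^ i\<close> has the coordinates \<open>a\<^sub>0, \<dots>, a\<^sub>d\<close>.\<close>

definition form_coord :: "nat \<Rightarrow> 'a::field poly poly \<Rightarrow> nat \<Rightarrow> 'a" where
  "form_coord d f i = coeff (coeff f i) (d - i)"

definition proj_zeros :: "nat \<Rightarrow> 'a::field mpolynomial set \<Rightarrow> 'a poly poly set set" where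
  "proj_zeros d F =
     {p \<in> proj_forms d. \<forall>P\<in>F. \<forall>f\<in>p. mpoly_eval P (form_coord d f) = 0}"

definition zariski_topology :: "nat \<Rightarrow> 'a::field poly poly set topology" where
  "zariski_topology d =
     topology (\<lambda>U. \<exists>F. F \<subseteq> homogeneous_polys d \<and> U = proj_forms d - proj_zeros d F)"


subsection \<open>Homogeneous polynomials are well behaved under evaluation\<close>

lemma monom_eval_superset:
  assumes "finite A" "Poly_Mapping.keys m \<subseteq> A"
  shows "monom_eval m x = (\<Prod>i\<in>A. x i ^ Poly_Mapping.lookup m i)"
  unfolding monom_eval_def
  by (rule prod.mono_neutral_left) (use assms in \<open>auto simp: in_keys_iff\<close>)

lemma monom_degree_superset:
  assumes "finite A" "Poly_Mapping.keys m \<subseteq> A"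
  shows "monom_degree m = (\<Sum>i\<in>A. Poly_Mapping.lookup m i)"
  unfolding monom_degree_def
  by (rule sum.mono_neutral_left) (use assms in \<open>auto simp: in_keys_iff\<close>)

lemma mpoly_eval_superset:
  assumes "finite A" "Poly_Mapping.keys P \<subseteq> A"
  shows "mpoly_eval P x = (\<Sum>m\<in>A. Poly_Mapping.lookup P m * monom_eval m x)"
  unfolding mpoly_eval_def
  by (rule sum.mono_neutral_left) (use assms in \<open>auto simp: in_keys_iff\<close>)

lemma monom_eval_add: "monom_eval (m + n) x = monom_eval m x * monom_eval n x"
proof -
  let ?A = "Poly_Mapping.keys m \<union> Poly_Mapping.keys n"
  have "Poly_Mapping.keys (m + n) \<subseteq> ?A"
    by (rule Poly_Mapping.keys_add)
  then show ?thesis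
    by (simp add: monom_eval_superset[of ?A] lookup_add power_add prod.distrib)
qed

lemma monom_degree_add: "monom_degree (m + n) = monom_degree m + monom_degree n"
proof -
  let ?A = "Poly_Mapping.keys m \<union> Poly_Mapping.keys n"
  have "Poly_Mapping.keys (m + n) \<subseteq> ?A"
    by (rule Poly_Mapping.keys_add)
  then show ?thesis
    by (simp add: monom_degree_superset[of ?A] lookup_add sum.distrib)
qed

lemma mpoly_eval_zero [simp]: "mpoly_eval 0 x = 0"
  by (simp add: mpoly_eval_def)

lemma mpoly_eval_single [simp]: "mpoly_eval (Poly_Mapping.single m c) x = c * monom_eval m x"
  by (cases "c = 0") (simp_all add: mpoly_eval_def)

lemma mpoly_eval_add: "mpoly_eval (P + Q) x = mpoly_eval P x + mpoly_eval Q x"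
proof -
  let ?A = "Poly_Mapping.keys P \<union> Poly_Mapping.keys Q"
  have "Poly_Mapping.keys (P + Q) \<subseteq> ?A"
    by (rule Poly_Mapping.keys_add)
  then show ?thesis
    by (simp add: mpoly_eval_superset[of ?A] lookup_add distrib_right sum.distrib)
qed

lemma mpoly_eval_sum: "mpoly_eval (\<Sum>i\<in>A. P i) x = (\<Sum>i\<in>A. mpoly_eval (P i) x)"
  by (induction A rule: infinite_finite_induct) (simp_all add: mpoly_eval_add)

lemma mpoly_sum_monomials:
  "(P :: 'a::field mpolynomial) =
     (\<Sum>m\<in>Poly_Mapping.keys P. Poly_Mapping.single m (Poly_Mapping.lookup P m))"
  by (rule poly_mapping_eqI) (auto simp: lookup_sum lookup_single when_def in_keys_iff)

lemma mpoly_eval_mult: "mpoly_eval (P * Q) x = mpoly_eval P x * mpoly_eval Q x"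
proof -
  have "P * Q = (\<Sum>m\<in>Poly_Mapping.keys P. Poly_Mapping.single m (Poly_Mapping.lookup P m)) *
      (\<Sum>n\<in>Poly_Mapping.keys Q. Poly_Mapping.single n (Poly_Mapping.lookup Q n))"
    by (simp flip: mpoly_sum_monomials)
  also have "\<dots> = (\<Sum>m\<in>Poly_Mapping.keys P. \<Sum>n\<in>Poly_Mapping.keys Q.
      Poly_Mapping.single (m + n) (Poly_Mapping.lookup P m * Poly_Mapping.lookup Q n))"
    by (simp add: sum_product mult_single)
  finally have "mpoly_eval (P * Q) x = (\<Sum>m\<in>Poly_Mapping.keys P. \<Sum>n\<in>Poly_Mapping.keys Q.
      (Poly_Mapping.lookup P m * monom_eval m x) * (Poly_Mapping.lookup Q n * monom_eval n x))"
    by (simp add: mpoly_eval_sum monom_eval_add mult_ac)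
  then show ?thesis
    by (simp add: mpoly_eval_def sum_product)
qed

lemma homogeneous_polys_mult:
  assumes "P \<in> homogeneous_polys d" "Q \<in> homogeneous_polys d"
  shows "P * Q \<in> homogeneous_polys d"
proof -
  obtain a b where a: "\<forall>m\<in>Poly_Mapping.keys P. monom_degree m = a"
    and b: "\<forall>m\<in>Poly_Mapping.keys Q. monom_degree m = b"
    using assms by (auto simp: homogeneous_polys_def)
  have "Poly_Mapping.keys m \<subseteq> {..d} \<and> monom_degree m = a + b"
    if m: "m \<in> Poly_Mapping.keys (P * Q)" for m
  proof -
    obtain s t where st: "s \<in> Poly_Mapping.keys P" "t \<in> Poly_Mapping.keys Q" "m = s + t"
      using m keys_mult[of P Q] by blast
    then have "Poly_Mapping.keys s \<subseteq> {..d}" "Poly_Mapping.keys t \<subseteq> {..d}"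
      using assms by (auto simp: homogeneous_polys_def)
    then show ?thesis
      using Poly_Mapping.keys_add[of s t] st a b by (auto simp: monom_degree_add)
  qed
  then show ?thesis
    unfolding homogeneous_polys_def by blast
qed

lemma monom_eval_scale: "monom_eval m (\<lambda>i. c * x i) = c ^ monom_degree m * monom_eval m x"
  by (simp add: monom_eval_def monom_degree_def power_mult_distrib prod.distrib power_sum)

lemma mpoly_eval_proportional:
  assumes "P \<in> homogeneous_polys d" "(f, g) \<in> proportional d"
  shows "mpoly_eval P (form_coord d g) = 0 \<longleftrightarrow> mpoly_eval P (form_coord d f) = 0"
proof -
  obtain c where c: "c \<noteq> 0" "g = smult [:c:] f"
    using assms(2) by (auto simp: proportional_def)
  obtain e where e: "\<forall>m\<in>Poly_Mapping.keys P. monom_degree m = e"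
    using assms(1) by (auto simp: homogeneous_polys_def)
  have "form_coord d g = (\<lambda>i. c * form_coord d f i)"
    by (auto simp: form_coord_def c)
  then have "mpoly_eval P (form_coord d g) = c ^ e * mpoly_eval P (form_coord d f)"
    using e by (simp add: mpoly_eval_def monom_eval_scale sum_distrib_left mult_ac)
  then show ?thesis
    using c by simp
qed


subsection \<open>The Zariski topology is a topology\<close>

lemma proj_zeros_Un:
  assumes "F \<subseteq> homogeneous_polys d" "G \<subseteq> homogeneous_polys d"
  shows "proj_zeros d F \<union> proj_zeros d G = proj_zeros d {P * Q | P Q. P \<in> F \<and> Q \<in> G}"
    (is "?L = ?R")
proof
  show "?L \<subseteq> ?R"
    by (auto simp: proj_zeros_def mpoly_eval_mult)
  show "?R \<subseteq> ?L"
  proof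
    fix p assume p: "p \<in> ?R"
    show "p \<in> ?L"
    proof (rule ccontr)
      assume "p \<notin> ?L"
      then obtain P Q f g where PQ: "P \<in> F" "Q \<in> G" and fg: "f \<in> p" "g \<in> p"
        and P: "mpoly_eval P (form_coord d f) \<noteq> 0" and Q: "mpoly_eval Q (form_coord d g) \<noteq> 0"
        using p by (auto simp: proj_zeros_def)
      have "(f, g) \<in> proportional d"
        using p fg quotient_eq_iff[OF equiv_proportional, of p d p f g]
        by (auto simp: proj_zeros_def proj_forms_def)
      then have "mpoly_eval Q (form_coord d f) \<noteq> 0"
        using Q PQ assms mpoly_eval_proportional by blast
      moreover have "mpoly_eval (P * Q) (form_coord d f) = 0"
        using p PQ fg by (auto simp: proj_zeros_def)
      ultimately show False
        using P by (simp add: mpoly_eval_mult)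
    qed
  qed
qed

lemma istopology_zariski:
  "istopology (\<lambda>U. \<exists>F. F \<subseteq> homogeneous_polys d \<and> U = proj_forms d - proj_zeros d F)"
  unfolding istopology_def
proof (intro conjI allI impI)
  fix S T :: "'a poly poly set set"
  assume "\<exists>F. F \<subseteq> homogeneous_polys d \<and> S = proj_forms d - proj_zeros d F"
    and "\<exists>F. F \<subseteq> homogeneous_polys d \<and> T = proj_forms d - proj_zeros d F"
  then obtain F G where F: "F \<subseteq> homogeneous_polys d" "S = proj_forms d - proj_zeros d F"
    and G: "G \<subseteq> homogeneous_polys d" "T = proj_forms d - proj_zeros d G"
    by blast
  have "S \<inter> T = proj_forms d - (proj_zeros d F \<union> proj_zeros d G)"
    using F(2) G(2) by blast
  then have "S \<inter> T = proj_forms d - proj_zeros d {P * Q | P Q. P \<in> F \<and> Q \<in> G}"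
    by (simp only: proj_zeros_Un[OF F(1) G(1)])
  moreover have "{P * Q | P Q. P \<in> F \<and> Q \<in> G} \<subseteq> homogeneous_polys d"
    using F(1) G(1) by (auto intro: homogeneous_polys_mult)
  ultimately show "\<exists>F. F \<subseteq> homogeneous_polys d \<and> S \<inter> T = proj_forms d - proj_zeros d F"
    by blast
next
  fix \<K> :: "'a poly poly set set set"
  assume "\<forall>K\<in>\<K>. \<exists>F. F \<subseteq> homogeneous_polys d \<and> K = proj_forms d - proj_zeros d F"
  then obtain F where F: "\<And>K. K \<in> \<K> \<Longrightarrow> F K \<subseteq> homogeneous_polys d"
      "\<And>K. K \<in> \<K> \<Longrightarrow> K = proj_forms d - proj_zeros d (F K)"
    by metis
  have "\<Union>\<K> = (\<Union>K\<in>\<K>. proj_forms d - proj_zeros d (F K))"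
    using F(2) by auto
  also have "\<dots> = proj_forms d - proj_zeros d (\<Union>K\<in>\<K>. F K)"
    by (auto simp: proj_zeros_def)
  finally have "\<Union>\<K> = proj_forms d - proj_zeros d (\<Union>K\<in>\<K>. F K)" .
  moreover have "(\<Union>K\<in>\<K>. F K) \<subseteq> homogeneous_polys d"
    using F(1) by (rule UN_least)
  ultimately show "\<exists>F. F \<subseteq> homogeneous_polys d \<and> \<Union>\<K> = proj_forms d - proj_zeros d F"
    by (intro exI conjI)
qed

lemma openin_zariski:
  "openin (zariski_topology d) U \<longleftrightarrow>
     (\<exists>F. F \<subseteq> homogeneous_polys d \<and> U = proj_forms d - proj_zeros d F)"
  unfolding zariski_topology_def by (simp add: topology_inverse'[OF istopology_zariski])

lemma topspace_zariski [simp]: "topspace (zariski_topology d) = proj_forms d"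
proof -
  have one: "1 \<in> homogeneous_polys d" "\<And>x. mpoly_eval (1 :: 'a mpolynomial) x = 1"
    by (simp_all add: homogeneous_polys_def mpoly_eval_def monom_eval_def)
  have "f \<in> proportional d `` {f}" if "f \<in> binary_forms d - {0}" for f :: "'a poly poly"
    using that equiv_class_self[OF equiv_proportional] by blast
  then have "proj_zeros d {1 :: 'a mpolynomial} = {}"
    unfolding proj_zeros_def proj_forms_def quotient_def using one(2) by fastforce
  then have "openin (zariski_topology d) (proj_forms d :: 'a poly poly set set)"
    unfolding openin_zariski using one(1) by (intro exI[of _ "{1}"]) auto
  moreover have "U \<subseteq> proj_forms d" if "openin (zariski_topology d) U" for U :: "'a poly poly set set"
    using that by (auto simp: openin_zariski)
  ultimately show ?thesis
    by (meson openin_subset openin_topspace subset_antisym)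
qed

lemma closedin_zariski:
  "closedin (zariski_topology d) Z \<longleftrightarrow> (\<exists>F. F \<subseteq> homogeneous_polys d \<and> Z = proj_zeros d F)"
proof -
  have sub: "proj_zeros d F \<subseteq> proj_forms d" for F :: "'a mpolynomial set"
    by (auto simp: proj_zeros_def)
  have "Z \<subseteq> proj_forms d \<and> proj_forms d - Z = proj_forms d - proj_zeros d F \<longleftrightarrow>
      Z = proj_zeros d F" for F
    using sub[of F] by blast
  then show ?thesis
    unfolding closedin_def topspace_zariski openin_zariski by blast
qed

end

theory Submission
  imports Defs "Jordan_Normal_Form.Determinant" "HOL-Library.Function_Algebras"
begin

text \<open>
  A form \<open>f\<close> of degree \<open>d\<close> is regarded as a linear functional on polynomials of degree at most \<open>d\<close>;
  powers of linear forms become evaluations at points of the projective line. If \<open>g\<close> is a form of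
  lowest degree \<open>t\<close> apolar to \<open>f\<close>, then the Waring rank is \<open>t\<close> if \<open>g\<close> is squarefree and \<open>d + 2 - t\<close>
  otherwise (Sylvester). Hence the right-hand side of the theorem is the set of forms apolar to a form
  of degree \<open>k + 2\<close> with a double root. It is closed: away from it, either there is no apolar form of
  degree \<open>k + 2\<close>, or it is unique up to scalars and Cramer's rule writes it as a polynomial in \<open>f\<close>,
  whose discriminant gives an equation. The stratum is dense in it: for fixed \<open>g\<close> with a double root the
  forms apolar to \<open>g\<close> form a linear space, and those without an apolar form of degree \<open>k + 1\<close> are open in
  this space, and nonempty because of the residue functional of \<open>1 / g\<close>.
\<close>

text \<open>The number \<open>d + 2 - t\<close> is the degree of the second generator of the apolar
  ideal of \<open>f\<close>, a complete intersection of two forms without common zero. Of this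
  structure the following is proved: the gcd of two apolar forms is apolar if their degrees are not
  too large; hence below degree \<open>d + 2 - t\<close> every apolar form is a multiple of
  \<open>g\<close>. In that degree a dimension count yields a form prime to \<open>g\<close>, and a
  general member of the pencil that it spans with a multiple of \<open>g\<close> has simple roots.
  The hypothesis on \<open>d - k\<close> says \<open>2 * (k + 2) \<le> d + 1\<close>, which makes an
  apolar form of degree \<open>k + 2\<close> unique up to scalars when there is none of lower
  degree. Closedness is shown point by point: each point outside the locus gets an equation that
  vanishes on the locus and not at this point. The Hankel matrix of the apolarity conditions need
  not be square, so it is first multiplied by a left inverse of its value at the point. Density is
  reduced to polynomials in one variable by restriction to a line. Forms are dehomogenised; a root
  at infinity is a drop in degree, and this causes most case distinctions.\<close>

hide_const (open) Determinants.det module.smult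

text \<open>A nonzero combination of least degree divides every combination, because the remainder
  is again a combination.\<close>

lemma poly_bezout:
  fixes P Q :: "'a::field poly"
  assumes "P \<noteq> 0"
  obtains h A B where "h \<noteq> 0" "h dvd P" "h dvd Q" "h = A * P + B * Q"
proof -
  define I where "I h \<longleftrightarrow> h \<noteq> 0 \<and> (\<exists>A B. h = A * P + B * Q)" for h
  have "I P"
    using assms unfolding I_def by (metis add_0_right mult_1 mult_zero_left)
  then obtain h where h: "I h" and min: "\<And>h'. I h' \<Longrightarrow> degree h \<le> degree h'"
    using exists_least_lemma[of "\<lambda>n. \<exists>h. I h \<and> degree h = n"]
    by (metis ex_has_least_nat)
  obtain A B where AB: "h = A * P + B * Q" and h0: "h \<noteq> 0"
    using h by (auto simp: I_def)
  have dvd: "h dvd F" if F: "F = C * P + D * Q" for F C D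
  proof -
    have "F mod h = (C - F div h * A) * P + (D - F div h * B) * Q"
      using F AB by (simp add: algebra_simps minus_mult_div_eq_mod[symmetric])
    then have "I (F mod h)" if "F mod h \<noteq> 0"
      using that unfolding I_def by blast
    then have "F mod h = 0"
      using min[of "F mod h"] degree_mod_less[OF h0, of F] by linarith
    then show ?thesis
      by (simp only: mod_eq_0_iff_dvd)
  qed
  show ?thesis
    by (rule that[OF h0 dvd[of P 1 0] dvd[of Q 0 1] AB]) simp_all
qed

section \<open>Apolarity\<close>

text \<open>\<open>b\<close> lists the values of a functional on the powers of the variable. The
  binomial factors of the usual apolarity pairing are absorbed by \<open>dual_coord\<close>
  below.\<close>

definition pairing :: "(nat \<Rightarrow> 'a::field) \<Rightarrow> 'a poly \<Rightarrow> 'a" where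
  "pairing b p = (\<Sum>i\<le>degree p. coeff p i * b i)"

lemma pairing_alt: "degree p \<le> n \<Longrightarrow> pairing b p = (\<Sum>i\<le>n. coeff p i * b i)"
  unfolding pairing_def by (rule sum.mono_neutral_left) (auto simp: coeff_eq_0)

lemma pairing_0 [simp]: "pairing b 0 = 0"
  by (simp add: pairing_def)

lemma pairing_add: "pairing b (p + q) = pairing b p + pairing b q"
proof -
  define n where "n = max (degree p) (degree q)"
  have "degree p \<le> n" "degree q \<le> n" "degree (p + q) \<le> n"
    by (auto simp: n_def degree_add_le_max)
  then show ?thesis
    by (simp add: pairing_alt[of _ n] distrib_right sum.distrib)
qed

lemma pairing_smult: "pairing b (smult c p) = c * pairing b p"
  by (simp add: pairing_alt[of "smult c p" "degree p"] pairing_def sum_distrib_left mult.assoc)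

lemma pairing_sum: "pairing b (\<Sum>i\<in>A. p i) = (\<Sum>i\<in>A. pairing b (p i))"
  by (induction A rule: infinite_finite_induct) (auto simp: pairing_add)

lemma pairing_monom: "pairing b (monom c i) = c * b i"
  by (subst pairing_alt[of _ i]) (auto simp: degree_monom_le if_distrib[of "\<lambda>x. x * _"] cong: if_cong)

text \<open>
  A binary form of degree \<open>s\<close> is given by the dehomogenised polynomial together with \<open>s\<close>; the
  difference of \<open>s\<close> and the degree of the polynomial is the multiplicity of the root at infinity.
\<close>

definition apolar :: "nat \<Rightarrow> (nat \<Rightarrow> 'a::field) \<Rightarrow> nat \<Rightarrow> 'a poly \<Rightarrow> bool" where
  "apolar d b s g \<longleftrightarrow> s \<le> d \<and> degree g \<le> s \<and> (\<forall>p. degree p \<le> d - s \<longrightarrow> pairing b (g * p) = 0)"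

text \<open>\<open>s \<le> degree g + 1\<close> says that infinity is at most a simple root.\<close>

definition sqfree_form :: "nat \<Rightarrow> 'a::field poly \<Rightarrow> bool" where
  "sqfree_form s g \<longleftrightarrow> g \<noteq> 0 \<and> degree g \<le> s \<and> s \<le> degree g + 1 \<and> rsquarefree g"

lemma apolar_smult: "apolar d b s g \<Longrightarrow> apolar d b s (smult c g)"
  by (auto simp: apolar_def pairing_smult)

lemma apolar_add: "apolar d b s g \<Longrightarrow> apolar d b s h \<Longrightarrow> apolar d b s (g + h)"
  by (auto simp: apolar_def pairing_add distrib_right degree_add_le)

lemma apolar_mult:
  assumes "apolar d b s g" "s \<le> r" "r \<le> d" "degree A \<le> r - s"
  shows "apolar d b r (g * A)"
proof -
  have "degree (g * A) \<le> r"
    using assms degree_mult_le[of g A] unfolding apolar_def by linarith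
  moreover have "degree (A * p) \<le> d - s" if "degree p \<le> d - r" for p
    using that assms degree_mult_le[of A p] by linarith
  ultimately show ?thesis
    using assms unfolding apolar_def by (auto simp: mult.assoc)
qed

lemma apolar_monom_iff:
  "apolar d b s g \<longleftrightarrow> s \<le> d \<and> degree g \<le> s \<and> (\<forall>i\<le>d - s. pairing b (g * monom 1 i) = 0)"
proof -
  have expand: "pairing b (g * p) = (\<Sum>i\<le>n. coeff p i * pairing b (g * monom 1 i))" if "degree p \<le> n" for n p
  proof -
    have "pairing b (g * p) = pairing b (g * (\<Sum>i\<le>n. monom (coeff p i) i))"
      using that by (simp add: poly_as_sum_of_monoms')
    also have "\<dots> = pairing b (\<Sum>i\<le>n. smult (coeff p i) (g * monom 1 i))"
      by (simp add: sum_distrib_left smult_monom flip: mult_smult_right)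
    finally show ?thesis
      by (simp add: pairing_sum pairing_smult)
  qed
  have "pairing b (g * p) = 0"
    if "\<forall>i\<le>d - s. pairing b (g * monom 1 i) = 0" "degree p \<le> d - s" for p
    using expand[OF that(2)] that(1) by simp
  then have "(\<forall>p. degree p \<le> d - s \<longrightarrow> pairing b (g * p) = 0) \<longleftrightarrow>
      (\<forall>i\<le>d - s. pairing b (g * monom 1 i) = 0)"
    by (metis degree_monom_eq zero_neq_one)
  then show ?thesis
    unfolding apolar_def by simp
qed

text \<open>Together with \<open>apolar_monom_iff\<close> this turns apolarity into the kernel of
  the Hankel (catalecticant) matrix \<open>b (i + j)\<close> with \<open>d - s + 1\<close> rows and
  \<open>s + 1\<close> columns.\<close>

lemma pairing_mult_monom:
  assumes "degree g \<le> s"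
  shows "pairing b (g * monom 1 i) = (\<Sum>j\<le>s. b (i + j) * coeff g j)"
proof -
  have "pairing b (g * monom 1 i) = pairing b ((\<Sum>j\<le>s. monom (coeff g j) j) * monom 1 i)"
    using assms by (simp add: poly_as_sum_of_monoms')
  also have "\<dots> = (\<Sum>j\<le>s. b (i + j) * coeff g j)"
    by (simp add: sum_distrib_right mult_monom pairing_sum pairing_monom) (simp add: ac_simps)
  finally show ?thesis .
qed

lemma apolar_const_imp_zero:
  assumes "apolar d b 0 g" "g \<noteq> 0" "i \<le> d"
  shows "b i = 0"
proof -
  have "coeff g 0 \<noteq> 0"
    using assms by (metis apolar_def le_zero_eq leading_coeff_0_iff)
  moreover have "coeff g 0 * b i = 0"
    using assms pairing_mult_monom[of g 0 b i] by (auto simp: apolar_monom_iff mult.commute)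
  ultimately show ?thesis
    by simp
qed

text \<open>The cofactor of \<open>Q\<close> is reduced modulo \<open>P\<close>, so its degree is
  below \<open>s\<close>, and \<open>s + r \<le> e + 1\<close> turns this into \<open>e - r\<close>.
  Only \<open>P\<close> must attain its degree bound; \<open>Q\<close> may have a root at
  infinity.\<close>

lemma bezout_degree:
  fixes P Q :: "'a::field poly"
  assumes bez: "A0 * P + B0 * Q = 1" and F: "degree F \<le> e"
    and P: "degree P = s" and Q: "degree Q \<le> r" and "s + r \<le> e + 1" "s \<le> e" "r \<le> e" "P \<noteq> 0"
  obtains A B where "F = A * P + B * Q" "degree A \<le> e - s" "degree B \<le> e - r"
proof -
  define B where "B = (F * B0) mod P"
  define A where "A = F * A0 + (F * B0) div P * Q"
  have eq: "F = A * P + B * Q"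
  proof -
    have "A * P + B * Q = F * A0 * P + ((F * B0) div P * P + (F * B0) mod P) * Q"
      by (simp only: A_def B_def ring_distribs ac_simps)
    also have "\<dots> = F * (A0 * P + B0 * Q)"
      by (simp only: div_mult_mod_eq) (simp add: algebra_simps)
    finally show ?thesis using bez by simp
  qed
  have B: "B = 0 \<or> degree B < s"
    using degree_mod_less[OF \<open>P \<noteq> 0\<close>, of "F * B0"] P by (auto simp: B_def)
  then have dB: "degree B \<le> e - r"
    using assms by auto
  have "degree (B * Q) \<le> e"
    using degree_mult_le[of B Q] Q dB \<open>r \<le> e\<close> by linarith
  moreover have "A * P = F - B * Q"
    using eq by (simp add: algebra_simps)
  ultimately have "degree (A * P) \<le> e"
    using F degree_diff_le by metis
  then have "degree A \<le> e - s"
    using P \<open>P \<noteq> 0\<close> by (cases "A = 0") (auto simp: degree_mult_eq)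
  then show ?thesis using that eq dB by blast
qed

text \<open>\<open>c\<close> is the degree of the homogeneous gcd, common roots at infinity
  included. After division by the gcd, \<open>bezout_degree\<close> writes each test polynomial
  \<open>p\<close> as a combination of the coprime quotients; then \<open>h * p\<close> is a sum of
  admissible multiples of \<open>P\<close> and \<open>Q\<close>.\<close>

lemma apolar_gcd:
  fixes P Q :: "'a::field poly"
  assumes P: "apolar d b s P" "P \<noteq> 0" and Q: "apolar d b r Q" "Q \<noteq> 0"
    and h: "h dvd P" "h dvd Q" "h = A * P + B * Q"
    and c: "c = degree h + min (s - degree P) (r - degree Q)" and sr: "s + r \<le> d + 1 + c"
  shows "apolar d b c h"
proof -
  obtain P' Q' where P': "P = h * P'" and Q': "Q = h * Q'"
    using h(1,2) unfolding dvd_def by blast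
  have nz: "h \<noteq> 0" "P' \<noteq> 0" "Q' \<noteq> 0"
    using P' Q' P Q by auto
  have deg: "degree P = degree h + degree P'" "degree Q = degree h + degree Q'"
    using P' Q' nz by (auto simp: degree_mult_eq)
  have le: "degree P \<le> s" "degree Q \<le> r" "s \<le> d" "r \<le> d"
    using P Q by (auto simp: apolar_def)
  have "h * (A * P' + B * Q') = A * (h * P') + B * (h * Q')"
    by (simp add: algebra_simps)
  also have "\<dots> = h * 1"
    by (simp only: P'[symmetric] Q'[symmetric] h(3)[symmetric] mult_1_right)
  finally have "h * (A * P' + B * Q') = h * 1" .
  then have bez: "A * P' + B * Q' = 1"
    using nz by (simp only: mult_cancel_left) auto
  have "pairing b (h * p) = 0" if p: "degree p \<le> d - c" for p
  proof -
    have "\<exists>C D. p = C * P' + D * Q' \<and> degree C \<le> d - s \<and> degree D \<le> d - r"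
    \<comment> \<open>The form with the smaller order at infinity loses its root there on division
      by the gcd; its quotient has exact degree, as \<open>bezout_degree\<close> demands of one of
      the two.\<close>
    proof (cases "s - degree P \<le> r - degree Q")
      case True
      with deg le c sr have "degree P' = s - c" "degree Q' \<le> r - c" "(s - c) + (r - c) \<le> (d - c) + 1"
         "s - c \<le> d - c" "r - c \<le> d - c" "d - c - (s - c) = d - s" "d - c - (r - c) = d - r"
        by auto
      then show ?thesis
        using bezout_degree[OF bez p _ _ _ _ _ nz(2), of "s - c" "r - c"] by metis
    next
      case False
      have bez': "B * Q' + A * P' = 1"
        using bez by (simp add: add.commute)
      from False deg le c sr have "degree Q' = r - c" "degree P' \<le> s - c" "(r - c) + (s - c) \<le> (d - c) + 1"
         "s - c \<le> d - c" "r - c \<le> d - c" "d - c - (s - c) = d - s" "d - c - (r - c) = d - r"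
        by auto
      then show ?thesis
        using bezout_degree[OF bez' p _ _ _ _ _ nz(3), of "r - c" "s - c"] by (metis add.commute)
    qed
    then obtain C D where CD: "p = C * P' + D * Q'" "degree C \<le> d - s" "degree D \<le> d - r"
      by blast
    have "h * p = P * C + Q * D"
      using CD(1) P' Q' by (simp add: algebra_simps)
    then show ?thesis
      using P(1) Q(1) CD by (simp add: pairing_add apolar_def)
  qed
  then show ?thesis
    using c deg le by (auto simp: apolar_def)
qed

section \<open>Linear systems over a field\<close>

lemma det_eq_0_iff_kernel:
  fixes A :: "'a::field mat"
  assumes A: "A \<in> carrier_mat n n"
  shows "det A = 0 \<longleftrightarrow> (\<exists>c. (\<exists>j<n. c j \<noteq> 0) \<and> (\<forall>i<n. (\<Sum>j<n. A $$ (i, j) * c j) = 0))"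
proof -
  have mv: "A *\<^sub>v v = 0\<^sub>v n \<longleftrightarrow> (\<forall>i<n. (\<Sum>j<n. A $$ (i, j) * vec_index v j) = 0)" if "v \<in> carrier_vec n" for v
    using A that by (auto simp: vec_eq_iff scalar_prod_def atLeast0LessThan)
  show ?thesis
  proof
    assume "det A = 0"
    then obtain v where v: "v \<in> carrier_vec n" "v \<noteq> 0\<^sub>v n" "A *\<^sub>v v = 0\<^sub>v n"
      using det_0_iff_vec_prod_zero_field[OF A] by blast
    then have "\<exists>j<n. vec_index v j \<noteq> 0"
      by (auto simp: vec_eq_iff)
    then show "\<exists>c. (\<exists>j<n. c j \<noteq> 0) \<and> (\<forall>i<n. (\<Sum>j<n. A $$ (i, j) * c j) = 0)"
      using v mv[OF v(1)] by blast
  next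
    assume "\<exists>c. (\<exists>j<n. c j \<noteq> 0) \<and> (\<forall>i<n. (\<Sum>j<n. A $$ (i, j) * c j) = 0)"
    then obtain c j where c: "j < n" "c j \<noteq> 0" "\<forall>i<n. (\<Sum>j<n. A $$ (i, j) * c j) = 0"
      by blast
    have "vec n c \<noteq> 0\<^sub>v n"
      using c by (metis index_vec index_zero_vec(1))
    moreover have "A *\<^sub>v vec n c = 0\<^sub>v n"
      by (subst mv) (use c in auto)
    ultimately show "det A = 0"
      using det_0_iff_vec_prod_zero_field[OF A] by (metis vec_carrier)
  qed
qed

text \<open>Zero rows pad the system to a square one; expansion along the zero row \<open>m\<close>
  shows that its determinant vanishes.\<close>

lemma underdetermined_system:
  fixes f :: "nat \<Rightarrow> nat \<Rightarrow> 'a::field"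
  assumes "m < n"
  obtains c j where "j < n" "c j \<noteq> 0" "\<And>i. i < m \<Longrightarrow> (\<Sum>j<n. f i j * c j) = 0"
proof -
  define A where "A = mat n n (\<lambda>(i, j). if i < m then f i j else 0)"
  have A: "A \<in> carrier_mat n n"
    by (simp add: A_def)
  have "det A = (\<Sum>j<n. A $$ (m, j) * cofactor A m j)"
    by (rule laplace_expansion_row[OF A]) (use assms in auto)
  also have "\<dots> = 0"
    using assms by (intro sum.neutral) (auto simp: A_def)
  finally obtain c j where c: "j < n" "c j \<noteq> 0" "\<forall>i<n. (\<Sum>j<n. A $$ (i, j) * c j) = 0"
    unfolding det_eq_0_iff_kernel[OF A] by blast
  have "(\<Sum>j<n. f i j * c j) = 0" if "i < m" for i
    using that assms c(3)[rule_format, of i] by (simp add: A_def)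
  then show ?thesis
    using that c by blast
qed

section \<open>Apolar forms of least degree\<close>

definition min_apolar :: "nat \<Rightarrow> (nat \<Rightarrow> 'a::field) \<Rightarrow> nat \<Rightarrow> 'a poly \<Rightarrow> bool" where
  "min_apolar d b s g \<longleftrightarrow> apolar d b s g \<and> g \<noteq> 0 \<and> (\<forall>c<s. \<forall>h. apolar d b c h \<longrightarrow> h = 0)"

text \<open>The Hankel system has \<open>d - s + 1\<close> equations in \<open>s + 1\<close>
  unknowns, and \<open>d < 2 * s\<close> leaves it underdetermined.\<close>

lemma apolar_exists:
  fixes b :: "nat \<Rightarrow> 'a::field"
  assumes "s \<le> d" "d < 2 * s"
  obtains g where "apolar d b s g" "g \<noteq> 0"
proof -
  have lt: "d - s + 1 < s + 1"
    using assms by linarith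
  obtain c k where c: "k < s + 1" "c k \<noteq> 0" "\<And>i. i < d - s + 1 \<Longrightarrow> (\<Sum>j<s + 1. b (i + j) * c j) = 0"
    using underdetermined_system[OF lt, of "\<lambda>i j. b (i + j)"] by metis
  define g where "g = (\<Sum>j\<le>s. monom (c j) j)"
  have coeff: "coeff g j = (if j \<le> s then c j else 0)" for j
    by (simp add: g_def coeff_sum sum.delta')
  have "degree g \<le> s"
    by (rule degree_le) (simp add: coeff)
  then have "apolar d b s g"
    using assms c(3) by (auto simp: apolar_monom_iff pairing_mult_monom coeff less_Suc_eq_le
        simp flip: lessThan_Suc_atMost)
  moreover have "g \<noteq> 0"
    using c(1,2) coeff[of k] by auto
  ultimately show ?thesis
    by (rule that)
qed

lemma min_apolar_exists:
  assumes "i \<le> d" "b i \<noteq> 0" "d \<ge> 1"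
  obtains s g where "min_apolar d b s g" "1 \<le> s" "2 * s \<le> d + 2"
proof -
  define S where "S s \<longleftrightarrow> (\<exists>g. apolar d b s g \<and> g \<noteq> 0)" for s
  define s where "s = (LEAST s. S s)"
  \<comment> \<open>The smallest degree in which counting alone forces an apolar form; it is the
    source of the bound \<open>2 * s \<le> d + 2\<close>.\<close>
  have top: "S (d div 2 + 1)"
  proof -
    have "d div 2 + 1 \<le> d" "d < 2 * (d div 2 + 1)"
      using assms by presburger+
    then show ?thesis
      using apolar_exists unfolding S_def by metis
  qed
  then have "S s"
    unfolding s_def by (rule LeastI)
  then obtain g where g: "apolar d b s g" "g \<noteq> 0"
    by (auto simp: S_def)
  have "s \<le> d div 2 + 1"
    unfolding s_def by (rule Least_le) (rule top)
  moreover have "\<not> S c" if "c < s" for c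
    using that not_less_Least unfolding s_def by blast
  then have "min_apolar d b s g"
    using g by (auto simp: min_apolar_def S_def)
  moreover have "s \<noteq> 0"
    using g apolar_const_imp_zero assms by metis
  ultimately show ?thesis
    by (intro that) auto
qed

text \<open>By \<open>apolar_gcd\<close> the gcd is apolar, so minimality of \<open>s\<close> forces
  it to have the full degree \<open>s\<close>, and it is \<open>g\<close> up to a scalar. The second
  conclusion is divisibility at infinity.\<close>

lemma min_apolar_gcd:
  fixes g q :: "'a::field poly"
  assumes g: "min_apolar d b s g" and q: "apolar d b r q" "q \<noteq> 0"
    and h: "h \<noteq> 0" "h dvd g" "h dvd q" "h = A * g + B * q"
    and sr: "s + r \<le> d + 1 + (degree h + min (s - degree g) (r - degree q))"
  shows "g dvd q" "s - degree g \<le> r - degree q"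
proof -
  have g': "apolar d b s g" "g \<noteq> 0" "degree g \<le> s"
    using g by (auto simp: min_apolar_def apolar_def)
  define c where "c = degree h + min (s - degree g) (r - degree q)"
  have "apolar d b c h"
    using apolar_gcd[OF g'(1,2) q h(2-4) c_def] sr by (simp add: c_def)
  then have "s \<le> c"
    using g h(1) unfolding min_apolar_def by (meson not_less)
  moreover have "degree h \<le> degree g"
    by (rule dvd_imp_degree_le) (use h g' in auto)
  ultimately have dh: "degree h = degree g" and "s - degree g \<le> r - degree q"
    using g'(3) unfolding c_def by linarith+
  then show "s - degree g \<le> r - degree q"
    by simp
  obtain k where k: "g = h * k"
    using h(2) by (auto simp: dvd_def)
  then have "degree k = 0"
    using dh g'(2) by (simp add: degree_mult_eq)
  then obtain e where e: "k = [:e:]"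
    by (rule degree_eq_zeroE)
  then have "h = smult (inverse e) g"
    using k g' by auto
  then show "g dvd q"
    using h(3) smult_dvd_cancel by blast
qed

text \<open>Below the complementary degree \<open>d + 2 - s\<close> the degree condition of
  \<open>min_apolar_gcd\<close> holds whatever the gcd is.\<close>

lemma min_apolar_dvd:
  fixes g q :: "'a::field poly"
  assumes g: "min_apolar d b s g" and q: "apolar d b r q" "q \<noteq> 0" and sr: "s + r \<le> d + 1"
  shows "g dvd q" "s - degree g \<le> r - degree q"
proof -
  have "g \<noteq> 0"
    using g by (simp add: min_apolar_def)
  then obtain h A B where h: "h \<noteq> 0" "h dvd g" "h dvd q" "h = A * g + B * q"
    using poly_bezout by blast
  show "g dvd q" "s - degree g \<le> r - degree q"
    using min_apolar_gcd[OF g q h] sr by auto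
qed

text \<open>The case \<open>r = s\<close> of \<open>min_apolar_dvd\<close>: divisibility at infinity
  bounds the degree of \<open>h\<close> by that of \<open>g\<close>, so the cofactor is
  constant.\<close>

lemma min_apolar_unique:
  fixes g h :: "'a::field poly"
  assumes g: "min_apolar d b s g" and h: "apolar d b s h" and s: "2 * s \<le> d + 1"
  obtains c where "h = smult c g"
proof (cases "h = 0")
  case True
  then show ?thesis using that[of 0] by simp
next
  case False
  then have "g dvd h" "s - degree g \<le> s - degree h"
    using min_apolar_dvd[OF g h] s by auto
  moreover have "degree g \<le> s" "degree h \<le> s"
    using g h by (auto simp: min_apolar_def apolar_def)
  ultimately have "g dvd h" "degree h \<le> degree g"
    by auto
  then obtain k where k: "h = g * k"
    by (auto simp: dvd_def)
  then have "degree k = 0"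
    using \<open>degree h \<le> degree g\<close> False by (auto simp: degree_mult_eq)
  then obtain e where "k = [:e:]"
    by (rule degree_eq_zeroE)
  then show ?thesis
    using that[of e] k by simp
qed

section \<open>Squarefree apolar forms\<close>

lemma rsquarefree_dvd:
  fixes p q :: "'a::field_char_0 poly"
  assumes "rsquarefree q" "p dvd q"
  shows "rsquarefree p"
  using assms unfolding rsquarefree_roots dvd_def by (auto simp: pderiv_mult)

text \<open>The lower bound in Sylvester's theorem: in this range \<open>q\<close> is a multiple of
  \<open>g\<close>, also at infinity, so simple roots of \<open>q\<close> pass to
  \<open>g\<close>.\<close>

lemma min_apolar_sqfree:
  fixes g q :: "'a::field_char_0 poly"
  assumes g: "min_apolar d b s g" and q: "apolar d b r q" "sqfree_form r q" and sr: "s + r \<le> d + 1"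
  shows "sqfree_form s g"
proof -
  have "q \<noteq> 0"
    using q by (simp add: sqfree_form_def)
  then show ?thesis
    using min_apolar_dvd[OF g q(1) _ sr] q g rsquarefree_dvd
    unfolding sqfree_form_def min_apolar_def apolar_def by fastforce
qed

lemma poly_avoid_finite:
  fixes p :: "'a::field_char_0 poly"
  assumes "p \<noteq> 0" "finite S"
  obtains x where "poly p x \<noteq> 0" "x \<notin> S"
proof -
  have "finite ({x. poly p x = 0} \<union> S)"
    using assms by (simp add: poly_roots_finite)
  then obtain x where "x \<notin> {x. poly p x = 0} \<union> S"
    using ex_new_if_finite[OF infinite_UNIV_char_0] by blast
  then show ?thesis
    using that by blast
qed

text \<open>A Bertini argument. At a double root of \<open>P + smult c Q\<close> both this
  polynomial and its derivative vanish, so the root is one of the finitely many zeros of the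
  Wronskian \<open>W\<close>, and it determines \<open>c\<close>.\<close>

lemma pencil_sqfree:
  fixes P Q :: "'a::field_char_0 poly"
  assumes bez: "A * P + B * Q = 1" and deg: "degree P \<le> r" "degree Q \<le> r" "degree P = r \<or> degree Q = r"
    and "r \<ge> 1"
  obtains c where "sqfree_form r (P + smult c Q)"
proof -
  define W where "W = P * pderiv Q - pderiv P * Q"
  have "W \<noteq> 0"
  proof
    assume "W = 0"
    then have eq: "P * pderiv Q = pderiv P * Q"
      by (simp add: W_def)
    \<comment> \<open>With \<open>W = 0\<close>, multiplying the derivatives by the Bezout identity
      shows that \<open>P\<close> and \<open>Q\<close> divide their own derivatives, so in
      characteristic zero both are constant.\<close>
    have "pderiv P = pderiv P * (A * P + B * Q)" "pderiv Q = pderiv Q * (A * P + B * Q)"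
      by (simp_all add: bez)
    moreover have "pderiv P * (A * P + B * Q) = P * (A * pderiv P + B * pderiv Q)"
      "pderiv Q * (A * P + B * Q) = Q * (A * pderiv P + B * pderiv Q)"
      using eq by (simp_all add: algebra_simps)
    ultimately have "P dvd pderiv P" "Q dvd pderiv Q"
      by (metis dvd_triv_left)+
    then have "degree P = 0" "degree Q = 0"
      using not_dvd_pderiv by blast+
    then show False
      using deg \<open>r \<ge> 1\<close> by auto
  qed
  \<comment> \<open>The first value would cancel the coefficient at \<open>r\<close> and put a root
    at infinity. Quotients with denominator 0 only add harmless elements.\<close>
  define bad where "bad = insert (- coeff P r / coeff Q r) ((\<lambda>x. - poly P x / poly Q x) ` {x. poly W x = 0})"
  have "finite bad"
    using \<open>W \<noteq> 0\<close> by (simp add: bad_def poly_roots_finite)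
  then obtain c where c: "c \<notin> bad"
    using ex_new_if_finite[OF infinite_UNIV_char_0] by blast
  define F where "F = P + smult c Q"
  have "coeff F r \<noteq> 0"
  proof
    assume F0: "coeff F r = 0"
    show False
    proof (cases "coeff Q r = 0")
      case True
      then have "degree Q \<noteq> r"
        using \<open>r \<ge> 1\<close> leading_coeff_0_iff by fastforce
      then have "degree P = r"
        using deg by simp
      then show False
        using F0 True \<open>r \<ge> 1\<close> leading_coeff_0_iff by (fastforce simp: F_def)
    next
      case False
      then have "c = - coeff P r / coeff Q r"
        using F0 by (simp add: F_def field_simps eq_neg_iff_add_eq_0)
      then show False
        using c by (simp add: bad_def)
    qed
  qed
  moreover have "degree F \<le> r"
    using deg by (auto simp: F_def intro!: degree_add_le)
  ultimately have dF: "degree F = r" "F \<noteq> 0"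
    by (auto intro!: antisym le_degree)
  have "rsquarefree F"
    unfolding rsquarefree_roots
  proof (intro allI notI)
    fix x assume x: "poly F x = 0 \<and> poly (pderiv F) x = 0"
    have P: "poly P x = - c * poly Q x" "poly (pderiv P) x = - c * poly (pderiv Q) x"
      using x by (simp_all add: F_def pderiv_add pderiv_smult eq_neg_iff_add_eq_0)
    then have "poly W x = 0"
      by (simp add: W_def)
    moreover have "poly Q x \<noteq> 0"
    proof
      assume "poly Q x = 0"
      then have "poly (A * P + B * Q) x = 0"
        using P by simp
      then show False
        by (simp add: bez)
    qed
    then have "c = - poly P x / poly Q x"
      using P by simp
    ultimately show False
      using c unfolding bad_def by blast
  qed
  then show ?thesis
    using that[of c] dF unfolding sqfree_form_def F_def by auto
qed

lemma comaximal_power: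
  fixes P Q u :: "'a::comm_ring_1"
  assumes "\<exists>A B. A * P + B * Q = 1" "\<exists>A B. A * u + B * Q = 1"
  shows "\<exists>A B. A * (P * u ^ n) + B * Q = 1"
proof (induction n)
  case 0
  then show ?case using assms by simp
next
  case (Suc n)
  then obtain A B where 1: "A * (P * u ^ n) + B * Q = 1" by blast
  obtain C D where 2: "C * u + D * Q = 1" using assms by blast
  have "(A * (P * u ^ n) + B * Q) * (C * u + D * Q) =
     (A * C) * (P * u ^ Suc n) + (A * (P * u ^ n) * D + B * C * u + B * D * Q) * Q"
    by (simp add: algebra_simps)
  then show ?case using 1 2 by (metis mult_1)
qed

text \<open>The second generator of the apolar ideal, prime to \<open>g\<close> also at infinity. In
  degree \<open>d + 2 - s\<close> apolarity imposes only \<open>s - 1\<close> conditions, so there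
  is a nonzero apolar form supported on any \<open>s\<close> prescribed exponents.\<close>

lemma min_apolar_complement:
  fixes g :: "'a::field poly"
  assumes g: "min_apolar d b s g" and s: "2 \<le> s" "2 * s \<le> d + 2"
  obtains q A B where "apolar d b (d + 2 - s) q" "A * g + B * q = 1"
    "degree g = s \<or> degree q = d + 2 - s"
proof -
  have g': "apolar d b s g" "g \<noteq> 0" "degree g \<le> s" "s \<le> d"
    using g by (auto simp: min_apolar_def apolar_def)
  define r where "r = d + 2 - s"
  define j where "j = degree g"
  \<comment> \<open>A nonzero multiple \<open>g * k\<close> with \<open>degree k \<le> r - s\<close>
    has degree between \<open>j\<close> and \<open>j + (r - s)\<close>. The exponents
    \<open>idx l\<close> with \<open>l < s\<close> are those up to \<open>r\<close> outside this
    block, so no nonzero combination of them is such a multiple.\<close>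
  define idx where "idx l = (if l < j then l else r + 1 - s + l)" for l
  have r: "s \<le> r" "s + r = d + 2" "r \<le> d" "d - r = s - 2"
    using s g' by (auto simp: r_def)
  have inj: "inj idx"
    by (auto simp: inj_def idx_def split: if_splits)
  have idx: "idx l \<le> r" if "l < s" for l
    using that r by (auto simp: idx_def)
  obtain c k where c: "k < s" "c k \<noteq> 0" "\<And>i. i < s - 1 \<Longrightarrow> (\<Sum>l<s. b (idx l + i) * c l) = 0"
    by (rule underdetermined_system[of "s - 1" s "\<lambda>i l. b (idx l + i)"]) (use s in auto)
  define q where "q = (\<Sum>l<s. monom (c l) (idx l))"
  have coeff: "coeff q n = (\<Sum>l<s. if idx l = n then c l else 0)" for n
    by (simp add: q_def coeff_sum)
  have coeff_idx: "coeff q (idx l) = c l" if "l < s" for l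
    unfolding coeff using that inj by (simp add: inj_eq)
  have dq: "degree q \<le> r"
    unfolding q_def by (intro degree_sum_le) (auto intro: order.trans[OF degree_monom_le] idx)
  have "pairing b (q * monom 1 i) = 0" if "i \<le> d - r" for i
  proof -
    have "pairing b (q * monom 1 i) = (\<Sum>l<s. c l * b (idx l + i))"
      by (simp add: q_def sum_distrib_right mult_monom pairing_sum pairing_monom)
    then show ?thesis
      using c(3)[of i] that r s by (simp add: mult.commute)
  qed
  then have q: "apolar d b r q"
    using dq r by (simp add: apolar_monom_iff)
  have q0: "q \<noteq> 0"
    using coeff_idx[of k] c by auto
  obtain h A B where h: "h \<noteq> 0" "h dvd g" "h dvd q" "h = A * g + B * q"
    using poly_bezout[OF g'(2)] by blast
  \<comment> \<open>As \<open>s + r = d + 2\<close>, a single common zero suffices for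
    \<open>min_apolar_gcd\<close>; then \<open>g\<close> would divide \<open>q\<close> with a
    cofactor of degree at most \<open>r - s\<close>, which the exponents of \<open>q\<close>
    exclude.\<close>
  have c0: "degree h + min (s - degree g) (r - degree q) = 0"
  proof (rule ccontr)
    assume "degree h + min (s - degree g) (r - degree q) \<noteq> 0"
    then have "s + r \<le> d + 1 + (degree h + min (s - degree g) (r - degree q))"
      using r by linarith
    from min_apolar_gcd[OF g q q0 h this] have *: "g dvd q" "s - j \<le> r - degree q"
      by (auto simp: j_def)
    then have "j \<le> degree q"
      using q0 by (simp add: j_def dvd_imp_degree_le)
    moreover have "coeff q (degree q) = 0"
    proof -
      have "idx l \<noteq> degree q" if "l < s" for l
        using that *(2) \<open>j \<le> degree q\<close> r dq by (auto simp: idx_def)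
      then show ?thesis
        unfolding coeff by (intro sum.neutral) auto
    qed
    ultimately show False
      using q0 by simp
  qed
  then obtain e where e: "h = [:e:]"
    by (auto elim: degree_eq_zeroE)
  with h(1) have "e \<noteq> 0"
    by simp
  have "smult (inverse e) A * g + smult (inverse e) B * q = smult (inverse e) h"
    using h(4) by (simp add: smult_add_right)
  also have "\<dots> = 1"
    using e \<open>e \<noteq> 0\<close> by (simp add: one_pCons)
  finally show ?thesis
    using that q c0 dq g' unfolding r_def by (metis add_is_0 diff_is_0_eq' le_antisym min_def diff_is_0_eq)
qed

text \<open>The upper bound in Sylvester's theorem: \<open>pencil_sqfree\<close> is applied to the
  complementary form and a multiple of \<open>g\<close> of the same degree.\<close>

lemma complementary_sqfree:
  fixes g :: "'a::field_char_0 poly"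
  assumes g: "min_apolar d b s g" and s: "2 \<le> s" "2 * s \<le> d + 2"
  obtains q where "apolar d b (d + 2 - s) q" "sqfree_form (d + 2 - s) q"
proof -
  define r where "r = d + 2 - s"
  obtain q A B where q: "apolar d b r q" and bez: "A * g + B * q = 1" and deg: "degree g = s \<or> degree q = r"
    using min_apolar_complement[OF assms] unfolding r_def by blast
  have g': "apolar d b s g" "g \<noteq> 0" "degree g \<le> s" "s \<le> d"
    using g by (auto simp: min_apolar_def apolar_def)
  have r: "s \<le> r" "r \<le> d"
    using s g' by (auto simp: r_def)
  have "q \<noteq> 0"
  proof
    assume "q = 0"
    then have "A * g = 1" "degree g = s"
      using bez deg s g' by (auto simp: r_def)
    then have "g dvd 1" "degree g \<noteq> 0"
      using s by (auto simp: dvd_def mult.commute)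
    then show False
      using is_unit_iff_degree[OF g'(2)] by simp
  qed
  then obtain a where a: "poly q a \<noteq> 0"
    by (metis poly_avoid_finite finite.emptyI)
  have bez_a: "\<exists>A B. A * [:- a, 1:] + B * q = 1"
  proof -
    have "[:- a, 1:] dvd q - [:poly q a:]"
      by (simp add: dvd_iff_poly_eq_0)
    then obtain k where k: "q - [:poly q a:] = [:- a, 1:] * k"
      by (auto simp: dvd_def)
    have "smult (- inverse (poly q a)) k * [:- a, 1:] + [:inverse (poly q a):] * q =
        smult (inverse (poly q a)) (q - [:- a, 1:] * k)"
      by (simp add: smult_diff_right mult.commute)
    also have "q - [:- a, 1:] * k = [:poly q a:]"
      using k by (simp add: algebra_simps)
    also have "smult (inverse (poly q a)) [:poly q a:] = 1"
      using a by (simp add: one_pCons)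
    finally show ?thesis
      by blast
  qed
  \<comment> \<open>The linear factor that raises \<open>g\<close> to degree \<open>r\<close> is not
    a factor of \<open>q\<close>, so coprimality survives.\<close>
  define P where "P = g * [:- a, 1:] ^ (r - s)"
  obtain C D where CD: "C * P + D * q = 1"
    using comaximal_power[of g q "[:- a, 1:]" "r - s"] bez bez_a unfolding P_def by blast
  have "degree ([:- a, 1:] ^ (r - s)) = r - s"
    by (simp add: degree_linear_power)
  then have dP: "degree P = degree g + (r - s)"
    unfolding P_def using g'(2) by (subst degree_mult_eq) auto
  have P: "apolar d b r P"
    unfolding P_def using r by (intro apolar_mult[OF g'(1)]) (auto simp: degree_linear_power)
  obtain c where c: "sqfree_form r (P + smult c q)"
    by (rule pencil_sqfree[OF CD]) (use dP deg r g' q s in \<open>auto simp: apolar_def\<close>)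
  then show ?thesis
    using that[of "P + smult c q"] P q unfolding r_def by (simp add: apolar_add apolar_smult)
qed

lemma double_root_iff:
  fixes g :: "'a::field poly"
  shows "poly g a = 0 \<and> poly (pderiv g) a = 0 \<longleftrightarrow> [:- a, 1:] ^ 2 dvd g"
proof
  assume "poly g a = 0 \<and> poly (pderiv g) a = 0"
  then obtain q where q: "g = [:- a, 1:] * q" and "poly (pderiv g) a = 0"
    by (auto simp: poly_eq_0_iff_dvd dvd_def)
  then have "poly q a = 0"
    by (simp add: pderiv_mult pderiv_pCons del: mult_pCons_left)
  then obtain k where "q = [:- a, 1:] * k"
    by (auto simp: poly_eq_0_iff_dvd dvd_def)
  then show "[:- a, 1:] ^ 2 dvd g"
    using q unfolding power2_eq_square by (metis dvd_triv_left mult.assoc)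
next
  assume "[:- a, 1:] ^ 2 dvd g"
  then obtain k where "g = [:- a, 1:] * ([:- a, 1:] * k)"
    unfolding power2_eq_square dvd_def by (metis mult.assoc)
  then show "poly g a = 0 \<and> poly (pderiv g) a = 0"
    by (simp add: pderiv_mult pderiv_pCons del: mult_pCons_left)
qed

lemma rsquarefree_prod_linear:
  fixes Y :: "'a::field_char_0 set"
  assumes "finite Y"
  shows "rsquarefree (\<Prod>y\<in>Y. [:- y, 1:])"
  unfolding rsquarefree_roots
proof (intro allI notI)
  fix a assume a: "poly (\<Prod>y\<in>Y. [:- y, 1:]) a = 0 \<and> poly (pderiv (\<Prod>y\<in>Y. [:- y, 1:])) a = 0"
  then have "a \<in> Y"
    using assms by (auto simp: poly_prod)
  then have "(\<Prod>y\<in>Y. [:- y, 1:]) = [:- a, 1:] * (\<Prod>y\<in>Y - {a}. [:- y, 1:])"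
    using assms by (rule prod.remove[rotated])
  then have "poly (\<Prod>y\<in>Y - {a}. [:- y, 1:]) a = 0"
    using a by (simp add: pderiv_mult pderiv_pCons del: mult_pCons_left)
  then show False
    using assms by (auto simp: poly_prod)
qed

lemma card_roots_rsquarefree:
  fixes g :: "'a::{alg_closed_field,field_char_0} poly"
  assumes "rsquarefree g"
  shows "card {x. poly g x = 0} = degree g"
  using assms
proof (induction "degree g" arbitrary: g)
  case 0
  then obtain e where "g = [:e:]"
    by (metis degree_eq_zeroE)
  then show ?case
    using 0 by (auto simp: rsquarefree_def)
next
  case (Suc n)
  then obtain a where "poly g a = 0"
    using alg_closed_imp_poly_has_root[of g] by auto
  then obtain q where q: "g = [:- a, 1:] * q"
    by (auto simp: poly_eq_0_iff_dvd dvd_def)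
  have "g \<noteq> 0"
    using Suc.hyps by auto
  then have "q \<noteq> 0"
    using q by auto
  have "poly (pderiv g) a = poly q a"
    by (simp add: q pderiv_mult pderiv_pCons del: mult_pCons_left)
  then have qa: "poly q a \<noteq> 0"
    using Suc.prems \<open>poly g a = 0\<close> by (auto simp: rsquarefree_roots)
  have "degree g = Suc (degree q)"
    using \<open>q \<noteq> 0\<close> by (simp add: q degree_mult_eq del: mult_pCons_left)
  then have "card {x. poly q x = 0} = degree q"
    using Suc rsquarefree_dvd[of g q] q by (metis Suc_inject dvd_triv_right)
  moreover have "{x. poly g x = 0} = insert a {x. poly q x = 0}"
    by (auto simp: q simp del: mult_pCons_left)
  ultimately show ?case
    using qa \<open>q \<noteq> 0\<close> \<open>degree g = Suc (degree q)\<close> by (simp add: poly_roots_finite)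
qed

section \<open>Waring rank and Sylvester's theorem\<close>

text \<open>The coordinates of a sum of \<open>d\<close>-th powers of
  \<open>\<alpha> j * u + \<beta> j * v\<close>, with the binomial factors removed.\<close>

definition power_sum_rep :: "nat \<Rightarrow> (nat \<Rightarrow> 'a::field) \<Rightarrow> nat \<Rightarrow> bool" where
  "power_sum_rep d b r \<longleftrightarrow>
     (\<exists>\<alpha> \<beta>. \<forall>i\<le>d. b i = (\<Sum>j<r. \<alpha> j ^ (d - i) * \<beta> j ^ i))"

text \<open>The apolar form has its simple roots at the points \<open>\<beta> j / \<alpha> j\<close>
  of the line, infinity being the point of a summand with \<open>\<alpha> j = 0\<close>.\<close>

lemma power_sum_rep_apolar:
  fixes b :: "nat \<Rightarrow> 'a::field_char_0"
  assumes rep: "power_sum_rep d b r" and r: "r \<le> d" "0 < d"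
  obtains g where "apolar d b r g" "sqfree_form r g"
proof -
  obtain \<alpha> \<beta> where b: "\<And>i. i \<le> d \<Longrightarrow> b i = (\<Sum>j<r. \<alpha> j ^ (d - i) * \<beta> j ^ i)"
    using rep unfolding power_sum_rep_def by blast
  define J where "J = {j. j < r \<and> \<alpha> j \<noteq> 0}"
  define K where "K = {j. j < r \<and> \<alpha> j = 0}"
  define Z where "Z = (\<lambda>j. \<beta> j / \<alpha> j) ` J"
  \<comment> \<open>The degree of the form to be built; it is one less than \<open>r\<close> if
    infinity must be a root.\<close>
  define n where "n = (if \<exists>j<r. \<alpha> j = 0 \<and> \<beta> j \<noteq> 0 then r - 1 else r)"
  have fin: "finite J" "finite K" "finite Z"
    by (auto simp: J_def K_def Z_def)
  have J: "card J \<le> n"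
  proof (cases "\<exists>j<r. \<alpha> j = 0 \<and> \<beta> j \<noteq> 0")
    case True
    then obtain j where "j < r" "\<alpha> j = 0"
      by blast
    then have "J \<subseteq> {..<r} - {j}"
      by (auto simp: J_def)
    then have "card J \<le> card ({..<r} - {j})"
      by (intro card_mono) auto
    then show ?thesis
      using True \<open>j < r\<close> by (simp add: n_def)
  next
    case False
    have "card J \<le> card {..<r}"
      by (intro card_mono) (auto simp: J_def)
    then show ?thesis
      unfolding n_def if_not_P[OF False] by simp
  qed
  then have "card Z \<le> n"
    unfolding Z_def using card_image_le[OF fin(1)] order.trans by blast
  \<comment> \<open>Coinciding points and zero linear forms can make \<open>Z\<close> too small.
    Arbitrary extra roots restore the degree without harm to apolarity.\<close>
  obtain X where X: "finite X" "card X = n - card Z" "X \<subseteq> - Z"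
    using infinite_arbitrarily_large[of "- Z"] fin(3) infinite_UNIV_char_0 by (metis finite_compl)
  define Y where "Y = Z \<union> X"
  have Y: "Z \<subseteq> Y" "finite Y" "card Y = n"
    using X fin(3) \<open>card Z \<le> n\<close> card_Un_disjoint[of Z X] by (auto simp: Y_def)
  define g where "g = (\<Prod>y\<in>Y. [:- y, 1:])"
  have g0: "g \<noteq> 0"
    using Y by (simp add: g_def)
  have dg: "degree g = n"
    unfolding g_def by (subst degree_prod_eq_sum_degree) (use Y in auto)
  have pg: "poly g x = 0 \<longleftrightarrow> x \<in> Y" for x
    using Y by (auto simp: g_def poly_prod)
  have "rsquarefree g"
    unfolding g_def using Y(2) by (rule rsquarefree_prod_linear)
  then have sq: "sqfree_form r g"
    using g0 dg by (auto simp: sqfree_form_def n_def)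
  \<comment> \<open>The functional is a sum of evaluations; the value at infinity of a form of
    degree \<open>d\<close> is its coefficient at \<open>d\<close>.\<close>
  have pair: "pairing b p = (\<Sum>j\<in>J. \<alpha> j ^ d * poly p (\<beta> j / \<alpha> j)) + (\<Sum>j\<in>K. \<beta> j ^ d * coeff p d)"
    if "degree p \<le> d" for p
  proof -
    have poly_eq: "poly p z = (\<Sum>i\<le>d. coeff p i * z ^ i)" for z
      unfolding poly_altdef using that by (intro sum.mono_neutral_left) (auto simp: coeff_eq_0)
    have "pairing b p = (\<Sum>i\<le>d. \<Sum>j<r. coeff p i * (\<alpha> j ^ (d - i) * \<beta> j ^ i))"
      using that b by (simp add: pairing_alt sum_distrib_left)
    also have "\<dots> = (\<Sum>j<r. \<Sum>i\<le>d. coeff p i * (\<alpha> j ^ (d - i) * \<beta> j ^ i))"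
      by (rule sum.swap)
    also have "{..<r} = J \<union> K"
      by (auto simp: J_def K_def)
    also have "(\<Sum>j\<in>J \<union> K. \<Sum>i\<le>d. coeff p i * (\<alpha> j ^ (d - i) * \<beta> j ^ i)) =
        (\<Sum>j\<in>J. \<Sum>i\<le>d. coeff p i * (\<alpha> j ^ (d - i) * \<beta> j ^ i)) +
        (\<Sum>j\<in>K. \<Sum>i\<le>d. coeff p i * (\<alpha> j ^ (d - i) * \<beta> j ^ i))"
      by (rule sum.union_disjoint) (use fin in \<open>auto simp: J_def K_def\<close>)
    also have "(\<Sum>j\<in>J. \<Sum>i\<le>d. coeff p i * (\<alpha> j ^ (d - i) * \<beta> j ^ i)) =
        (\<Sum>j\<in>J. \<alpha> j ^ d * poly p (\<beta> j / \<alpha> j))"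
    proof (rule sum.cong[OF refl])
      fix j assume "j \<in> J"
      then have "\<alpha> j ^ (d - i) * \<beta> j ^ i = \<alpha> j ^ d * (\<beta> j / \<alpha> j) ^ i" if "i \<le> d" for i
        using that by (simp add: J_def power_diff power_divide)
      then show "(\<Sum>i\<le>d. coeff p i * (\<alpha> j ^ (d - i) * \<beta> j ^ i)) = \<alpha> j ^ d * poly p (\<beta> j / \<alpha> j)"
        using poly_eq[of "\<beta> j / \<alpha> j"] by (simp add: sum_distrib_left mult.left_commute)
    qed
    also have "(\<Sum>j\<in>K. \<Sum>i\<le>d. coeff p i * (\<alpha> j ^ (d - i) * \<beta> j ^ i)) = (\<Sum>j\<in>K. \<beta> j ^ d * coeff p d)"
    proof (rule sum.cong[OF refl])
      fix j assume "j \<in> K"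
      then have "(\<Sum>i\<le>d. coeff p i * (\<alpha> j ^ (d - i) * \<beta> j ^ i)) = (\<Sum>i\<in>{d}. coeff p i * (\<alpha> j ^ (d - i) * \<beta> j ^ i))"
        by (intro sum.mono_neutral_right) (auto simp: K_def)
      then show "(\<Sum>i\<le>d. coeff p i * (\<alpha> j ^ (d - i) * \<beta> j ^ i)) = \<beta> j ^ d * coeff p d"
        by (simp add: mult.commute)
    qed
    finally show ?thesis .
  qed
  have "pairing b (g * p) = 0" if p: "degree p \<le> d - r" for p
  proof -
    have n: "n \<le> r"
      by (simp add: n_def)
    have "degree (g * p) \<le> n + (d - r)"
      using degree_mult_le[of g p] p dg by linarith
    moreover have "\<beta> j ^ d * coeff (g * p) d = 0" if "j \<in> K" for j
    proof (cases "\<beta> j = 0")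
      case True
      then show ?thesis using r by simp
    next
      case False
      then have "n = r - 1" "r > 0"
        using that by (auto simp: n_def K_def)
      then have "degree (g * p) < d"
        using \<open>degree (g * p) \<le> n + (d - r)\<close> r by linarith
      then show ?thesis
        by (simp add: coeff_eq_0)
    qed
    moreover have "poly (g * p) (\<beta> j / \<alpha> j) = 0" if "j \<in> J" for j
      using pg Y that by (auto simp: Z_def)
    ultimately have "(\<Sum>j\<in>J. \<alpha> j ^ d * poly (g * p) (\<beta> j / \<alpha> j)) = 0"
      "(\<Sum>j\<in>K. \<beta> j ^ d * coeff (g * p) d) = 0" "degree (g * p) \<le> d"
      using n r by (auto intro!: sum.neutral simp del: coeff_mult)
    then show ?thesis
      using pair by simp
  qed
  then have "apolar d b r g"
    using sq r by (auto simp: apolar_def sqfree_form_def)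
  then show ?thesis
    using sq that by blast
qed

text \<open>A \<open>d\<close>-th root absorbs each coefficient into its linear form. The extra
  index \<open>n\<close> is the point at infinity: with \<open>\<alpha> n = 0\<close> its term
  contributes to coordinate \<open>d\<close> only.\<close>

lemma linear_combination_power_sum_rep:
  fixes b :: "nat \<Rightarrow> 'a::alg_closed_field"
  assumes "finite Y" "card Y = n" "0 < d" and r: "r = n \<or> r = n + 1"
    and fin: "\<And>i. i < d \<Longrightarrow> b i = (\<Sum>y\<in>Y. c y * y ^ i)"
    and top: "b d = (\<Sum>y\<in>Y. c y * y ^ d) + e" and e: "r = n \<Longrightarrow> e = 0"
  shows "power_sum_rep d b r"
proof -
  have "\<exists>z. z ^ d = x" for x :: 'a
    using nth_root_exists[OF \<open>0 < d\<close>] by blast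
  then obtain \<rho> where \<rho>: "\<And>x::'a. \<rho> x ^ d = x"
    by metis
  obtain f where f: "bij_betw f {..<n} Y"
    using ex_bij_betw_nat_finite[OF assms(1)] assms(2) by (auto simp: atLeast0LessThan)
  have sum_f: "(\<Sum>y\<in>Y. c y * y ^ i) = (\<Sum>j<n. \<rho> (c (f j)) ^ (d - i) * (\<rho> (c (f j)) * f j) ^ i)"
    if "i \<le> d" for i
  proof -
    have "(\<Sum>y\<in>Y. c y * y ^ i) = (\<Sum>j<n. c (f j) * f j ^ i)"
      using f by (simp add: sum.reindex_bij_betw[OF f, symmetric])
    moreover have "c (f j) * f j ^ i = \<rho> (c (f j)) ^ (d - i) * (\<rho> (c (f j)) * f j) ^ i" for j
      using that \<rho>[of "c (f j)"] by (simp add: power_mult_distrib flip: power_add mult.assoc)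
    ultimately show ?thesis
      by simp
  qed
  define \<alpha> where "\<alpha> j = (if j < n then \<rho> (c (f j)) else 0)" for j
  define \<beta> where "\<beta> j = (if j < n then \<rho> (c (f j)) * f j else \<rho> e)" for j
  have part: "(\<Sum>j<n. \<alpha> j ^ (d - i) * \<beta> j ^ i) = (\<Sum>y\<in>Y. c y * y ^ i)" if "i \<le> d" for i
    unfolding sum_f[OF that] by (intro sum.cong) (auto simp: \<alpha>_def \<beta>_def)
  have "b i = (\<Sum>j<r. \<alpha> j ^ (d - i) * \<beta> j ^ i)" if i: "i \<le> d" for i
  proof -
    have "b i = (\<Sum>y\<in>Y. c y * y ^ i) + (if i = d then e else 0)"
      using fin top i by auto
    moreover have "\<alpha> n ^ (d - i) * \<beta> n ^ i = (if i = d then e else 0)"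
      using i \<rho> by (auto simp: \<alpha>_def \<beta>_def)
    ultimately show ?thesis
      using r e part[OF i] by auto
  qed
  then show ?thesis
    unfolding power_sum_rep_def by blast
qed

text \<open>The functional factors through the remainder modulo \<open>g\<close>, and Lagrange
  interpolation at the simple roots of \<open>g\<close> makes it a combination of
  evaluations.\<close>

lemma apolar_power_sum_rep:
  fixes b :: "nat \<Rightarrow> 'a::{alg_closed_field,field_char_0}"
  assumes ap: "apolar d b r g" and sq: "sqfree_form r g" and d: "0 < d"
  shows "power_sum_rep d b r"
proof -
  define Y where "Y = {x. poly g x = 0}"
  define n where "n = degree g"
  have g0: "g \<noteq> 0" and n: "n \<le> r" "r \<le> n + 1" and r: "r \<le> d"
    using sq ap by (auto simp: sqfree_form_def apolar_def n_def)
  have Y: "finite Y"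
    using g0 by (simp add: Y_def poly_roots_finite)
  have cY: "card Y = n"
    using sq card_roots_rsquarefree unfolding Y_def n_def sqfree_form_def by blast
  define l where "l y = smult (inverse (\<Prod>z\<in>Y - {y}. y - z)) (\<Prod>z\<in>Y - {y}. [:- z, 1:])" for y
  have l: "poly (l y) x = (if x = y then 1 else 0)" if "x \<in> Y" "y \<in> Y" for x y
    using that Y by (auto simp: l_def poly_prod)
  have dl: "degree (l y) < n" if "y \<in> Y" for y
  proof -
    have "degree (l y) \<le> card (Y - {y})"
      unfolding l_def by (rule order.trans[OF degree_smult_le], subst degree_prod_eq_sum_degree) auto
    also have "\<dots> < card Y"
      using that Y by (intro psubset_card_mono) auto
    finally show ?thesis using cY by simp
  qed
  define c where "c y = pairing b (l y)" for y
  \<comment> \<open>The bound on the degree is the one for which the quotient by \<open>g\<close>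
    has degree at most \<open>d - r\<close>.\<close>
  have interp: "pairing b p = (\<Sum>y\<in>Y. c y * poly p y)" if p: "degree p \<le> n + (d - r)" for p
  proof -
    define R where "R = p mod g"
    define L where "L = (\<Sum>y\<in>Y. smult (poly p y) (l y))"
    have pe: "p = g * (p div g) + R"
      by (simp add: R_def)
    have R: "R = 0 \<or> degree R < n"
      using degree_mod_less[OF g0, of p] by (auto simp: R_def n_def)
    have "degree (g * (p div g)) \<le> n + (d - r)"
    proof -
      have "g * (p div g) = p - R"
        using pe by (simp add: algebra_simps)
      then show ?thesis
        using p R degree_diff_le[of p "n + (d - r)" R] by auto
    qed
    then have "degree (p div g) \<le> d - r"
      using g0 by (cases "p div g = 0") (auto simp: degree_mult_eq n_def)
    then have "pairing b p = pairing b R"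
      using ap by (subst pe) (simp add: pairing_add apolar_def)
    also have "R = L"
    proof (cases "n = 0")
      case True
      then have "Y = {}"
        using cY Y by auto
      then show ?thesis
        using R True by (simp add: L_def)
    next
      case False
      show ?thesis
      proof (rule poly_eqI_degree[of Y])
        fix x assume x: "x \<in> Y"
        have "poly R x = poly p x"
          using x arg_cong[OF pe, of "\<lambda>p. poly p x"] by (simp add: Y_def)
        also have "\<dots> = (\<Sum>y\<in>Y. if x = y then poly p y else 0)"
          using x Y by simp
        also have "\<dots> = poly L x"
          unfolding L_def poly_sum using x l by (intro sum.cong) auto
        finally show "poly R x = poly L x" .
      next
        show "degree R < card Y"
          using R False cY by auto
        have "degree L \<le> n - 1"
          unfolding L_def using dl by (intro degree_sum_le Y)
            (metis degree_smult_le le_trans less_Suc_eq_le Suc_pred' False not_gr_zero)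
        then show "degree L < card Y"
          using False cY by auto
      qed
    qed
    finally show ?thesis
      by (simp add: L_def pairing_sum pairing_smult c_def mult.commute)
  qed
  have b_eq: "b i = (\<Sum>y\<in>Y. c y * y ^ i)" if "i \<le> n + (d - r)" for i
    using interp[of "monom 1 i"] that by (simp add: pairing_monom degree_monom_eq poly_monom)
  show ?thesis
    \<comment> \<open>If infinity is a root, then \<open>r = n + 1\<close> and interpolation stops
      at degree \<open>d - 1\<close>; the defect \<open>e\<close> in the top coordinate is the
      contribution of infinity. Otherwise \<open>e\<close> is 0.\<close>
    by (rule linear_combination_power_sum_rep[OF Y cY d, where c = c and e = "b d - (\<Sum>y\<in>Y. c y * y ^ d)"])
      (use n r b_eq in auto)
qed

text \<open>A representation shorter than \<open>\<rho>\<close> would give a squarefree apolar form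
  of degree \<open>r \<ge> s\<close>. So \<open>g\<close> is not squarefree and
  \<open>s + r \<le> d + 1\<close>, against \<open>min_apolar_sqfree\<close>.\<close>

theorem sylvester:
  fixes b :: "nat \<Rightarrow> 'a::{alg_closed_field,field_char_0}"
  assumes g: "min_apolar d b s g" and s: "1 \<le> s" "2 * s \<le> d + 2" and d: "0 < d"
  defines "\<rho> \<equiv> (if sqfree_form s g then s else d + 2 - s)"
  shows "power_sum_rep d b \<rho>" "\<And>r. r < \<rho> \<Longrightarrow> \<not> power_sum_rep d b r" "\<rho> \<le> d"
proof -
  have g': "apolar d b s g" "g \<noteq> 0" "degree g \<le> s" "s \<le> d"
    using g by (auto simp: min_apolar_def apolar_def)
  \<comment> \<open>A nonzero form of degree 1 has one simple root, possibly at infinity. Thus the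
    complementary degree occurs only for \<open>s \<ge> 2\<close>, where it is at most
    \<open>d\<close>.\<close>
  have s2: "2 \<le> s" if "\<not> sqfree_form s g"
  proof (rule ccontr)
    assume "\<not> 2 \<le> s"
    then have "degree g \<le> 1" "s = 1"
      using g' s by auto
    have "rsquarefree g"
      unfolding rsquarefree_roots
    proof (intro allI notI)
      fix a assume a: "poly g a = 0 \<and> poly (pderiv g) a = 0"
      then have "[:- a, 1:] ^ 2 dvd g"
        by (simp add: double_root_iff)
      then have "2 \<le> degree g"
        using g'(2) by (metis dvd_imp_degree_le degree_linear_power)
      then show False
        using \<open>degree g \<le> 1\<close> by simp
    qed
    then show False
      using that g' \<open>s = 1\<close> by (auto simp: sqfree_form_def)
  qed
  show "\<rho> \<le> d"
    using s2 g' by (auto simp: \<rho>_def)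
  show "power_sum_rep d b \<rho>"
  proof (cases "sqfree_form s g")
    case True
    then show ?thesis
      using apolar_power_sum_rep[OF g'(1) True d] by (simp add: \<rho>_def)
  next
    case False
    obtain q where "apolar d b (d + 2 - s) q" "sqfree_form (d + 2 - s) q"
      using complementary_sqfree[OF g s2[OF False] s(2)] by blast
    then show ?thesis
      using apolar_power_sum_rep d False by (auto simp: \<rho>_def)
  qed
  show "\<not> power_sum_rep d b r" if r: "r < \<rho>" for r
  proof
    assume "power_sum_rep d b r"
    then obtain q where q: "apolar d b r q" "sqfree_form r q"
      using power_sum_rep_apolar r \<open>\<rho> \<le> d\<close> d by (metis less_le_trans less_imp_le)
    then have "q \<noteq> 0"
      by (simp add: sqfree_form_def)
    then have "s \<le> r"
      using g q(1) unfolding min_apolar_def by (meson not_less)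
    then have "\<not> sqfree_form s g" "r < d + 2 - s"
      using r by (auto simp: \<rho>_def split: if_splits)
    then have "s + r \<le> d + 1"
      by linarith
    then show False
      using min_apolar_sqfree[OF g q] \<open>\<not> sqfree_form s g\<close> by blast
  qed
qed

section \<open>Homogeneous polynomial functions\<close>

text \<open>Equations are built as functions, such as determinants, and become polynomials only at
  the end. The explicit degree \<open>e\<close> is what permits sums.\<close>

definition hom_fun :: "nat \<Rightarrow> nat \<Rightarrow> ((nat \<Rightarrow> 'a::field) \<Rightarrow> 'a) \<Rightarrow> bool" where
  "hom_fun d e \<phi> \<longleftrightarrow> (\<exists>P. (\<forall>m\<in>Poly_Mapping.keys P. Poly_Mapping.keys m \<subseteq> {..d} \<and> monom_degree m = e) \<and>
     (\<forall>x. mpoly_eval P x = \<phi> x))"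

lemma hom_fun_imp_homogeneous:
  assumes "hom_fun d e \<phi>"
  obtains P where "P \<in> homogeneous_polys d" "\<And>x. mpoly_eval P x = \<phi> x"
  using assms unfolding hom_fun_def homogeneous_polys_def by blast

lemma hom_fun_0 [simp]: "hom_fun d e (\<lambda>x. 0)"
  unfolding hom_fun_def by (intro exI[of _ 0]) simp

lemma hom_fun_const: "hom_fun d 0 (\<lambda>x. c)"
  unfolding hom_fun_def
  by (intro exI[of _ "Poly_Mapping.single 0 c"]) (auto simp: monom_eval_def monom_degree_def)

lemma hom_fun_coord: "i \<le> d \<Longrightarrow> hom_fun d 1 (\<lambda>x. x i)"
  unfolding hom_fun_def
  by (intro exI[of _ "Poly_Mapping.single (Poly_Mapping.single i 1) 1"])
     (auto simp: monom_eval_def monom_degree_def)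

lemma hom_fun_add:
  assumes "hom_fun d e \<phi>" "hom_fun d e \<psi>"
  shows "hom_fun d e (\<lambda>x. \<phi> x + \<psi> x)"
proof -
  obtain P Q where P: "\<And>m. m \<in> Poly_Mapping.keys P \<Longrightarrow> Poly_Mapping.keys m \<subseteq> {..d} \<and> monom_degree m = e"
      "\<And>x. mpoly_eval P x = \<phi> x"
    and Q: "\<And>m. m \<in> Poly_Mapping.keys Q \<Longrightarrow> Poly_Mapping.keys m \<subseteq> {..d} \<and> monom_degree m = e"
      "\<And>x. mpoly_eval Q x = \<psi> x"
    using assms unfolding hom_fun_def by metis
  have "\<forall>m\<in>Poly_Mapping.keys (P + Q). Poly_Mapping.keys m \<subseteq> {..d} \<and> monom_degree m = e"
    using P(1) Q(1) Poly_Mapping.keys_add[of P Q] by blast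
  moreover have "\<forall>x. mpoly_eval (P + Q) x = \<phi> x + \<psi> x"
    by (simp add: mpoly_eval_add P Q)
  ultimately show ?thesis
    unfolding hom_fun_def by blast
qed

lemma hom_fun_mult:
  assumes "hom_fun d a \<phi>" "hom_fun d b \<psi>"
  shows "hom_fun d (a + b) (\<lambda>x. \<phi> x * \<psi> x)"
proof -
  obtain P Q where P: "\<And>m. m \<in> Poly_Mapping.keys P \<Longrightarrow> Poly_Mapping.keys m \<subseteq> {..d} \<and> monom_degree m = a"
      "\<And>x. mpoly_eval P x = \<phi> x"
    and Q: "\<And>m. m \<in> Poly_Mapping.keys Q \<Longrightarrow> Poly_Mapping.keys m \<subseteq> {..d} \<and> monom_degree m = b"
      "\<And>x. mpoly_eval Q x = \<psi> x"
    using assms unfolding hom_fun_def by metis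
  have "Poly_Mapping.keys m \<subseteq> {..d} \<and> monom_degree m = a + b" if m: "m \<in> Poly_Mapping.keys (P * Q)" for m
  proof -
    obtain s t where st: "s \<in> Poly_Mapping.keys P" "t \<in> Poly_Mapping.keys Q" "m = s + t"
      using m keys_mult[of P Q] by blast
    then show ?thesis
      using Poly_Mapping.keys_add[of s t] P(1)[OF st(1)] Q(1)[OF st(2)] by (auto simp: monom_degree_add)
  qed
  moreover have "\<forall>x. mpoly_eval (P * Q) x = \<phi> x * \<psi> x"
    by (simp add: mpoly_eval_mult P Q)
  ultimately show ?thesis
    unfolding hom_fun_def by blast
qed

lemma hom_fun_cmult: "hom_fun d e \<phi> \<Longrightarrow> hom_fun d e (\<lambda>x. c * \<phi> x)"
  using hom_fun_mult[OF hom_fun_const[of d c]] by fastforce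

lemma hom_fun_sum:
  "(\<And>i. i \<in> A \<Longrightarrow> hom_fun d e (\<phi> i)) \<Longrightarrow> hom_fun d e (\<lambda>x. \<Sum>i\<in>A. \<phi> i x)"
  by (induction A rule: infinite_finite_induct) (auto intro: hom_fun_add)

lemma hom_fun_prod:
  "finite A \<Longrightarrow> (\<And>i. i \<in> A \<Longrightarrow> hom_fun d (e i) (\<phi> i)) \<Longrightarrow>
     hom_fun d (\<Sum>i\<in>A. e i) (\<lambda>x. \<Prod>i\<in>A. \<phi> i x)"
  by (induction A rule: finite_induct) (auto intro: hom_fun_mult hom_fun_const)

text \<open>Degrees may depend on the row only; then all terms of the Leibniz formula have the same
  degree.\<close>

lemma hom_fun_det:
  assumes "\<And>x. A x \<in> carrier_mat n n"
    and "\<And>i j. i < n \<Longrightarrow> j < n \<Longrightarrow> hom_fun d (e i) (\<lambda>x. A x $$ (i, j))"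
  shows "hom_fun d (\<Sum>i<n. e i) (\<lambda>x. det (A x))"
proof -
  have "hom_fun d (\<Sum>i<n. e i) (\<lambda>x. \<Sum>p\<in>{p. p permutes {0..<n}}. signof p * (\<Prod>i = 0..<n. A x $$ (i, p i)))"
    unfolding atLeast0LessThan
    by (intro hom_fun_sum hom_fun_cmult hom_fun_prod assms(2))
       (auto simp: permutes_in_image dest: permutes_in_image)
  then show ?thesis
    by (simp add: det_def'[OF assms(1)])
qed

lemma hom_fun_line:
  assumes "hom_fun d e \<phi>"
  obtains Q where "\<And>t. \<phi> (\<lambda>i. (1 - t) * x i + t * y i) = poly Q t"
proof -
  obtain P where P: "\<And>x. mpoly_eval P x = \<phi> x"
    using assms unfolding hom_fun_def by blast
  define l where "l i = [:x i, y i - x i:]" for i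
  define Q where "Q = (\<Sum>m\<in>Poly_Mapping.keys P. smult (Poly_Mapping.lookup P m)
      (\<Prod>i\<in>Poly_Mapping.keys m. l i ^ Poly_Mapping.lookup m i))"
  have "poly (l i) t = (1 - t) * x i + t * y i" for i t
    by (simp add: l_def algebra_simps)
  then have "\<phi> (\<lambda>i. (1 - t) * x i + t * y i) = poly Q t" for t
    by (simp add: Q_def poly_sum poly_prod mpoly_eval_def monom_eval_def flip: P)
  then show ?thesis
    by (rule that)
qed

section \<open>Equations from determinants\<close>

lemma sum_fun_apply: "(\<Sum>i\<in>A. f i) k = (\<Sum>i\<in>A. f i k :: 'a::comm_monoid_add)"
  by (induction A rule: infinite_finite_induct) auto

lemma sum_mult_assoc:
  fixes B :: "'b \<Rightarrow> 'a::comm_semiring_0"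
  shows "(\<Sum>j\<in>J. (\<Sum>i\<in>I. B i * C i j) * v j) = (\<Sum>i\<in>I. B i * (\<Sum>j\<in>J. C i j * v j))"
  unfolding sum_distrib_left sum_distrib_right mult.assoc by (rule sum.swap)

text \<open>Multiplication by \<open>B\<close> makes a rectangular injective system square. When
  \<open>C\<close> varies and \<open>B\<close> stays fixed, the determinant of the product is a
  polynomial condition for injectivity, with no choice of a maximal minor.\<close>

lemma left_inverse_matrix:
  fixes C :: "nat \<Rightarrow> nat \<Rightarrow> 'a::field"
  assumes inj: "\<And>v. \<lbrakk>\<And>j. j \<notin> J \<Longrightarrow> v j = 0; \<And>i. i < m \<Longrightarrow> (\<Sum>j<n. C i j * v j) = 0\<rbrakk> \<Longrightarrow> v = (\<lambda>j. 0)"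
  obtains B where "\<And>v k. (\<And>j. j \<notin> J \<Longrightarrow> v j = 0) \<Longrightarrow> (\<Sum>i<m. B k i * (\<Sum>j<n. C i j * v j)) = v k"
proof -
  define sc :: "'a \<Rightarrow> (nat \<Rightarrow> 'a) \<Rightarrow> nat \<Rightarrow> 'a" where "sc a v = (\<lambda>i. a * v i)" for a v
  interpret V: vector_space sc
    by unfold_locales (auto simp: sc_def algebra_simps fun_eq_iff)
  interpret VV: vector_space_pair sc sc ..
  define f where "f v = (\<lambda>i. if i < m then \<Sum>j<n. C i j * v j else 0)" for v
  define S where "S = {v::nat \<Rightarrow> 'a. \<forall>j. j \<notin> J \<longrightarrow> v j = 0}"
  have lin: "Vector_Spaces.linear sc sc f"
    by unfold_locales (auto simp: f_def sc_def fun_eq_iff algebra_simps sum.distrib sum_distrib_left)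
  have sub: "V.subspace S"
    by (auto simp: V.subspace_def S_def sc_def)
  have "inj_on f S"
    unfolding VV.linear_inj_on_iff_eq_0[OF lin sub]
  proof (intro ballI impI)
    fix v assume v: "v \<in> S" "f v = 0"
    then have "(\<Sum>j<n. C i j * v j) = 0" if "i < m" for i
      using that by (auto simp: f_def fun_eq_iff zero_fun_def dest!: spec[of _ i])
    then show "v = 0"
      using inj[of v] v by (auto simp: S_def zero_fun_def)
  qed
  then obtain g where g: "Vector_Spaces.linear sc sc g" "\<And>v. v \<in> S \<Longrightarrow> g (f v) = v"
    using VV.linear_exists_left_inverse_on[OF lin sub] by blast
  interpret g: Vector_Spaces.linear sc sc g
    by (rule g(1))
  define u where "u i = (\<lambda>k. if k = i then 1 else 0 :: 'a)" for i :: nat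
  have "(\<Sum>i<m. g (u i) k * (\<Sum>j<n. C i j * v j)) = v k" if "\<And>j. j \<notin> J \<Longrightarrow> v j = 0" for v k
  proof -
    have "f v = (\<Sum>i<m. sc (\<Sum>j<n. C i j * v j) (u i))"
      by (rule ext) (auto simp: f_def u_def sc_def sum_fun_apply if_distrib cong: if_cong)
    then have "g (f v) = (\<Sum>i<m. sc (\<Sum>j<n. C i j * v j) (g (u i)))"
      by (simp add: g.sum g.scale)
    moreover have "g (f v) = v"
      using g(2) that by (simp add: S_def)
    ultimately have "v k = (\<Sum>i<m. sc (\<Sum>j<n. C i j * v j) (g (u i))) k"
      by simp
    then show ?thesis
      by (simp add: sum_fun_apply sc_def mult.commute)
  qed
  then show ?thesis
    by (rule that)
qed

text \<open>
  The form with coordinates \<open>x\<^sub>i\<close> acts on forms of the dual variables through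
  \<open>x\<^sub>i / (d choose i)\<close>; in these coordinates a power of a linear form is an evaluation functional.
\<close>

definition dual_coord :: "nat \<Rightarrow> (nat \<Rightarrow> 'a::field_char_0) \<Rightarrow> nat \<Rightarrow> 'a" where
  "dual_coord d x i = x i / of_nat (d choose i)"

lemma hom_fun_dual_coord: "i \<le> d \<Longrightarrow> hom_fun d 1 (\<lambda>x. dual_coord d x i)"
  using hom_fun_cmult[OF hom_fun_coord[of i d], of "inverse (of_nat (d choose i))"]
  by (simp add: dual_coord_def field_simps)

definition coeff_poly :: "nat \<Rightarrow> (nat \<Rightarrow> 'a::comm_monoid_add) \<Rightarrow> 'a poly" where
  "coeff_poly s v = (\<Sum>j\<le>s. monom (v j) j)"

lemma coeff_coeff_poly: "coeff (coeff_poly s v) j = (if j \<le> s then v j else 0)"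
  by (simp add: coeff_poly_def coeff_sum)

lemma degree_coeff_poly: "degree (coeff_poly s v) \<le> s"
  by (rule degree_le) (simp add: coeff_coeff_poly)

lemma apolar_coeff_poly:
  assumes "s \<le> d"
  shows "apolar d b s (coeff_poly s v) \<longleftrightarrow> (\<forall>i<d - s + 1. (\<Sum>j<s + 1. b (i + j) * v j) = 0)"
  using assms degree_coeff_poly[of s v]
  by (auto simp: apolar_monom_iff pairing_mult_monom coeff_coeff_poly less_Suc_eq_le
      simp flip: lessThan_Suc_atMost)

text \<open>\<open>B\<close> inverts the Hankel matrix at \<open>x0\<close> from the left, so
  \<open>N x0\<close> is the identity, and wherever \<open>det (N x)\<close> is nonzero the Hankel
  matrix has trivial kernel.\<close>

lemma apolar_equations:
  fixes x0 :: "nat \<Rightarrow> 'a::field_char_0"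
  assumes s: "s \<le> d" and x0: "\<And>g. apolar d (dual_coord d x0) s g \<Longrightarrow> g = 0"
  obtains e \<phi> where "hom_fun d e \<phi>" "\<phi> x0 \<noteq> 0"
    "\<And>x g. apolar d (dual_coord d x) s g \<Longrightarrow> \<phi> x \<noteq> 0 \<Longrightarrow> g = 0"
proof -
  define C where "C x i j = dual_coord d x (i + j)" for x :: "nat \<Rightarrow> 'a" and i j
  have inj: "v = (\<lambda>j. 0)"
    if v: "\<And>j. j \<notin> {..s} \<Longrightarrow> v j = 0" "\<And>i. i < d - s + 1 \<Longrightarrow> (\<Sum>j<s + 1. C x0 i j * v j) = 0" for v
  proof -
    have "apolar d (dual_coord d x0) s (coeff_poly s v)"
      using v(2) s by (simp add: apolar_coeff_poly C_def)
    then have "coeff_poly s v = 0"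
      by (rule x0)
    then have "coeff (coeff_poly s v) j = 0" for j
      by simp
    then have "v j = 0" for j
      using v(1)[of j] by (metis atMost_iff coeff_coeff_poly)
    then show ?thesis
      by auto
  qed
  obtain B where B: "\<And>v k. (\<And>j. j \<notin> {..s} \<Longrightarrow> v j = 0) \<Longrightarrow>
      (\<Sum>i<d - s + 1. B k i * (\<Sum>j<s + 1. C x0 i j * v j)) = v k"
    by (rule left_inverse_matrix[where J = "{..s}" and m = "d - s + 1" and n = "s + 1" and C = "C x0"]) (use inj in blast)+
  define N where "N x = mat (s + 1) (s + 1) (\<lambda>(k, j). \<Sum>i<d - s + 1. B k i * C x i j)" for x
  have N: "N x \<in> carrier_mat (s + 1) (s + 1)" for x
    by (simp add: N_def)
  have Nv: "(\<Sum>j<s + 1. N x $$ (k, j) * v j) = (\<Sum>i<d - s + 1. B k i * (\<Sum>j<s + 1. C x i j * v j))"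
    if "k < s + 1" for x k v
    using that by (simp add: N_def sum_mult_assoc del: sum.lessThan_Suc)
  show ?thesis
  proof (rule that)
    show "hom_fun d (\<Sum>k<s + 1. 1) (\<lambda>x. det (N x))"
    proof (rule hom_fun_det[OF N])
      fix k j assume "k < s + 1" "j < s + 1"
      then have "(\<lambda>x. N x $$ (k, j)) = (\<lambda>x. \<Sum>i<d - s + 1. B k i * dual_coord d x (i + j))"
        by (simp add: N_def C_def del: sum.lessThan_Suc)
      moreover have "i + j \<le> d" if "i < d - s + 1" for i
        using that \<open>j < s + 1\<close> s by linarith
      ultimately show "hom_fun d 1 (\<lambda>x. N x $$ (k, j))"
        by (simp only:) (intro hom_fun_sum hom_fun_cmult hom_fun_dual_coord, simp)
    qed
    show "det (N x0) \<noteq> 0"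
    proof
      assume "det (N x0) = 0"
      then obtain c j where c: "j < s + 1" "c j \<noteq> 0" "\<And>k. k < s + 1 \<Longrightarrow> (\<Sum>j<s + 1. N x0 $$ (k, j) * c j) = 0"
        unfolding det_eq_0_iff_kernel[OF N] by blast
      define v where "v j = (if j \<le> s then c j else 0)" for j
      have "v j = (\<Sum>i<d - s + 1. B j i * (\<Sum>j<s + 1. C x0 i j * v j))"
        by (rule B[symmetric]) (simp add: v_def)
      also have "\<dots> = (\<Sum>l<s + 1. N x0 $$ (j, l) * c l)"
        unfolding Nv[OF c(1), symmetric] by (intro sum.cong) (auto simp: v_def)
      finally show False
        using c by (simp add: v_def)
    qed
  next
    fix x g assume g: "apolar d (dual_coord d x) s g" and det: "det (N x) \<noteq> 0"
    have dg: "degree g \<le> s"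
      using g by (simp add: apolar_def)
    have gv: "g = coeff_poly s (coeff g)"
      by (rule poly_eqI) (use dg in \<open>auto simp: coeff_coeff_poly coeff_eq_0\<close>)
    have "(\<Sum>j<s + 1. C x i j * coeff g j) = 0" if "i < d - s + 1" for i
      using g that s by (subst (asm) gv) (simp only: apolar_coeff_poly C_def)
    then have "(\<Sum>j<s + 1. N x $$ (k, j) * coeff g j) = 0" if "k < s + 1" for k
      unfolding Nv[OF that] by (intro sum.neutral) auto
    then have "coeff g j = 0" if "j < s + 1" for j
      using det that unfolding det_eq_0_iff_kernel[OF N] by blast
    then show "g = 0"
      using dg by (intro poly_eqI) (metis coeff_0 coeff_eq_0 less_Suc_eq_le Suc_eq_plus1 not_le le_less_trans)
  qed
qed

section \<open>The discriminant\<close>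

text \<open>
  The two partial derivatives of the form \<open>g\<close> of degree \<open>s\<close> are \<open>pderiv g\<close> and \<open>s g - x pderiv g\<close>;
  the matrix below is that of \<open>(A, B) \<mapsto> A (s g - x pderiv g) + B pderiv g\<close> on forms of degree \<open>s - 2\<close>.
\<close>

definition polar_poly :: "nat \<Rightarrow> 'a::field poly \<Rightarrow> 'a poly" where
  "polar_poly s g = smult (of_nat s) g - pCons 0 (pderiv g)"

definition disc_mat :: "nat \<Rightarrow> 'a::field poly \<Rightarrow> 'a mat" where
  "disc_mat s g = mat (2 * (s - 1)) (2 * (s - 1)) (\<lambda>(n, l).
     if l < s - 1 then coeff (monom 1 l * polar_poly s g) n
     else coeff (monom 1 (l - (s - 1)) * pderiv g) n)"

lemma disc_mat_carrier: "disc_mat s g \<in> carrier_mat (2 * (s - 1)) (2 * (s - 1))"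
  by (simp add: disc_mat_def)

lemma coeff_polar_poly: "coeff (polar_poly s g) n = (of_nat s - of_nat n) * coeff g n"
  by (cases n) (simp_all add: polar_poly_def coeff_pderiv algebra_simps)

lemma degree_polar_poly:
  assumes "degree g \<le> s"
  shows "degree (polar_poly s g) \<le> s - 1"
proof (rule degree_le, intro allI impI)
  fix i assume "s - 1 < i"
  then have "i = s \<or> degree g < i"
    using assms by linarith
  then show "coeff (polar_poly s g) i = 0"
    by (auto simp: coeff_polar_poly coeff_eq_0)
qed

lemma sum_lessThan_add:
  fixes m n :: nat and f :: "nat \<Rightarrow> 'a::comm_monoid_add"
  shows "(\<Sum>i<m + n. f i) = (\<Sum>i<m. f i) + (\<Sum>i<n. f (m + i))"
  by (induction n) (auto simp: add.assoc)

lemma det_disc_mat_iff: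
  fixes g :: "'a::field_char_0 poly"
  assumes "degree g \<le> s" "2 \<le> s"
  shows "det (disc_mat s g) = 0 \<longleftrightarrow>
    (\<exists>A B. (A \<noteq> 0 \<or> B \<noteq> 0) \<and> degree A \<le> s - 2 \<and> degree B \<le> s - 2 \<and>
       A * polar_poly s g + B * pderiv g = 0)"
proof -
  define m where "m = s - 1"
  have m: "m \<ge> 1" "s - 2 = m - 1"
    using assms by (auto simp: m_def)
  have entry: "disc_mat s g $$ (n, l) = (if l < m then coeff (monom 1 l * polar_poly s g) n
     else coeff (monom 1 (l - m) * pderiv g) n)" if "n < 2 * m" "l < 2 * m" for n l
    using that by (simp add: disc_mat_def m_def)
  have expand: "(\<Sum>l<2 * m. disc_mat s g $$ (n, l) * c l) =
      coeff (coeff_poly (m - 1) c * polar_poly s g + coeff_poly (m - 1) (\<lambda>l. c (m + l)) * pderiv g) n"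
    if n: "n < 2 * m" for c n
  proof -
    have "(\<Sum>l<2 * m. disc_mat s g $$ (n, l) * c l) =
        (\<Sum>l<m. disc_mat s g $$ (n, l) * c l) + (\<Sum>l<m. disc_mat s g $$ (n, m + l) * c (m + l))"
      by (simp add: mult_2 sum_lessThan_add)
    also have "\<dots> = (\<Sum>l<m. coeff (monom (c l) l * polar_poly s g) n) +
        (\<Sum>l<m. coeff (monom (c (m + l)) l * pderiv g) n)"
      using n by (intro arg_cong2[where f = "(+)"] sum.cong) (auto simp: entry coeff_monom_mult)
    also have "\<dots> = coeff (coeff_poly (m - 1) c * polar_poly s g +
        coeff_poly (m - 1) (\<lambda>l. c (m + l)) * pderiv g) n"
    proof -
      have "{..m - 1} = {..<m}"
        using m by auto
      then show ?thesis
        by (simp add: coeff_poly_def sum_distrib_right coeff_sum)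
    qed
    finally show ?thesis .
  qed
  have dd: "degree (polar_poly s g) \<le> m" "degree (pderiv g) \<le> m"
    using degree_polar_poly[OF assms(1)] assms(1) degree_pderiv[of g] by (auto simp: m_def)
  have zero: "A * polar_poly s g + B * pderiv g = 0 \<longleftrightarrow>
      (\<forall>n<2 * m. coeff (A * polar_poly s g + B * pderiv g) n = 0)"
    if "degree A \<le> m - 1" "degree B \<le> m - 1" for A B
  proof -
    have "degree (A * polar_poly s g + B * pderiv g) \<le> 2 * m - 1"
      using that dd m degree_mult_le[of A "polar_poly s g"] degree_mult_le[of B "pderiv g"]
      by (intro degree_add_le) linarith+
    then have "coeff (A * polar_poly s g + B * pderiv g) n = 0" if "\<not> n < 2 * m" for n
      using that m by (intro coeff_eq_0) linarith
    then show ?thesis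
      by (auto simp: poly_eq_iff)
  qed
  show ?thesis
    unfolding det_eq_0_iff_kernel[OF disc_mat_carrier] m_def[symmetric] m(2)
  proof
    assume "\<exists>c. (\<exists>j<2 * m. c j \<noteq> 0) \<and> (\<forall>i<2 * m. (\<Sum>j<2 * m. disc_mat s g $$ (i, j) * c j) = 0)"
    then obtain c j where c: "j < 2 * m" "c j \<noteq> 0"
      "\<And>i. i < 2 * m \<Longrightarrow> (\<Sum>j<2 * m. disc_mat s g $$ (i, j) * c j) = 0"
      by blast
    define A where "A = coeff_poly (m - 1) c"
    define B where "B = coeff_poly (m - 1) (\<lambda>l. c (m + l))"
    have "degree A \<le> m - 1" "degree B \<le> m - 1"
      by (auto simp: A_def B_def degree_coeff_poly)
    moreover have "A * polar_poly s g + B * pderiv g = 0"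
      using zero[OF calculation] expand c(3) by (simp add: A_def B_def)
    moreover have "A \<noteq> 0 \<or> B \<noteq> 0"
    proof (cases "j < m")
      case True
      then have "coeff A j = c j"
        by (simp add: A_def coeff_coeff_poly)
      then show ?thesis using c by auto
    next
      case False
      then have "coeff B (j - m) = c j"
        using c(1) by (auto simp: B_def coeff_coeff_poly)
      then show ?thesis using c by auto
    qed
    ultimately show "\<exists>A B. (A \<noteq> 0 \<or> B \<noteq> 0) \<and> degree A \<le> m - 1 \<and> degree B \<le> m - 1 \<and>
       A * polar_poly s g + B * pderiv g = 0"
      by blast
  next
    assume "\<exists>A B. (A \<noteq> 0 \<or> B \<noteq> 0) \<and> degree A \<le> m - 1 \<and> degree B \<le> m - 1 \<and>
       A * polar_poly s g + B * pderiv g = 0"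
    then obtain A B where AB: "A \<noteq> 0 \<or> B \<noteq> 0" "degree A \<le> m - 1" "degree B \<le> m - 1"
       "A * polar_poly s g + B * pderiv g = 0"
      by blast
    define c where "c l = (if l < m then coeff A l else coeff B (l - m))" for l
    have A: "coeff_poly (m - 1) c = A"
      using AB(2) m by (intro poly_eqI) (auto simp: coeff_coeff_poly c_def coeff_eq_0)
    have B: "coeff_poly (m - 1) (\<lambda>l. c (m + l)) = B"
      using AB(3) m by (intro poly_eqI) (auto simp: coeff_coeff_poly c_def coeff_eq_0)
    have "\<forall>i<2 * m. (\<Sum>j<2 * m. disc_mat s g $$ (i, j) * c j) = 0"
      using expand[of _ c] unfolding A B AB(4) by simp
    moreover have "\<exists>j<2 * m. c j \<noteq> 0"
      using AB(1)
    proof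
      assume "A \<noteq> 0"
      then show ?thesis
        using AB(2) m by (intro exI[of _ "degree A"]) (auto simp: c_def)
    next
      assume "B \<noteq> 0"
      then show ?thesis
        using AB(3) m by (intro exI[of _ "m + degree B"]) (auto simp: c_def)
    qed
    ultimately show "\<exists>c. (\<exists>j<2 * m. c j \<noteq> 0) \<and> (\<forall>i<2 * m. (\<Sum>j<2 * m. disc_mat s g $$ (i, j) * c j) = 0)"
      by blast
  qed
qed

lemma comaximal_if_no_common_root:
  fixes P Q :: "'a::alg_closed_field poly"
  assumes "P \<noteq> 0" "\<And>a. \<not> (poly P a = 0 \<and> poly Q a = 0)"
  shows "\<exists>A B. A * P + B * Q = 1"
proof -
  obtain h A B where h: "h \<noteq> 0" "h dvd P" "h dvd Q" "h = A * P + B * Q"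
    using poly_bezout[OF assms(1)] by blast
  have "degree h = 0"
  proof (rule ccontr)
    assume "degree h \<noteq> 0"
    then obtain a where "poly h a = 0"
      using alg_closed_imp_poly_has_root[of h] by auto
    then show False
      using h(2,3) assms(2)[of a] by (auto simp: dvd_def)
  qed
  then obtain e where e: "h = [:e:]"
    by (rule degree_eq_zeroE)
  have "smult (inverse e) A * P + smult (inverse e) B * Q = smult (inverse e) h"
    by (simp add: h(4) smult_add_right)
  also have "\<dots> = 1"
    using e h(1) by (simp add: one_pCons)
  finally show ?thesis by blast
qed

lemma poly_dvd_cancel_comaximal:
  fixes P Q F :: "'a::comm_ring_1"
  assumes "A * P + B * Q = 1" "P dvd F * Q"
  shows "P dvd F"
proof -
  have "F = F * (A * P + B * Q)"
    using assms(1) by simp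
  also have "\<dots> = F * A * P + B * (F * Q)"
    by (simp add: algebra_simps)
  finally show ?thesis
    using assms(2) by (metis dvd_add dvd_mult dvd_triv_right)
qed

text \<open>By Euler's relation a double root, finite or at infinity, is a common zero of both
  partial derivatives. Without one they are coprime and have no relation with coefficients of degree
  at most \<open>s - 2\<close>.\<close>

lemma det_disc_mat:
  fixes g :: "'a::{alg_closed_field,field_char_0} poly"
  assumes dg: "degree g \<le> s" and s: "2 \<le> s"
  shows "det (disc_mat s g) = 0 \<longleftrightarrow> \<not> sqfree_form s g"
proof -
  let ?U = "polar_poly s g" and ?D = "pderiv g"
  have dU: "degree ?U \<le> s - 1"
    using dg by (rule degree_polar_poly)
  have UD: "poly ?U a = of_nat s * poly g a - a * poly ?D a" for a
    by (simp add: polar_poly_def)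
  show ?thesis
    unfolding det_disc_mat_iff[OF assms]
  proof
    assume "\<exists>A B. (A \<noteq> 0 \<or> B \<noteq> 0) \<and> degree A \<le> s - 2 \<and> degree B \<le> s - 2 \<and> A * ?U + B * ?D = 0"
    then obtain A B where AB: "A \<noteq> 0 \<or> B \<noteq> 0" "degree A \<le> s - 2" "degree B \<le> s - 2"
       "A * ?U + B * ?D = 0"
      by blast
    show "\<not> sqfree_form s g"
    proof
      assume sq: "sqfree_form s g"
      then have g0: "g \<noteq> 0" and rs: "rsquarefree g" and dg': "degree g = s \<or> degree g = s - 1"
        by (auto simp: sqfree_form_def)
      have nocommon: "\<not> (poly ?U a = 0 \<and> poly ?D a = 0)" for a
        using rs s UD[of a] by (auto simp: rsquarefree_roots)
      have nocommon': "\<not> (poly ?D a = 0 \<and> poly ?U a = 0)" for a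
        using nocommon[of a] by blast
      have D0: "?D \<noteq> 0"
        using dg' s g0 by (auto simp: pderiv_eq_0_iff)
      have U0: "?U \<noteq> 0" if "degree g = s - 1"
      proof -
        have "coeff g (s - 1) \<noteq> 0"
          using that g0 by (metis leading_coeff_0_iff)
        then show ?thesis
          using s coeff_polar_poly[of s g "s - 1"] by (auto simp: of_nat_diff)
      qed
      have "A * ?U = - (B * ?D)"
        using AB(4) by (simp add: eq_neg_iff_add_eq_0)
      then have dvd: "?D dvd A * ?U" "?U dvd B * ?D"
        by (metis dvd_minus_iff dvd_triv_right)+
      \<comment> \<open>The derivative of exact degree \<open>s - 1\<close> is
        \<open>pderiv g\<close> if \<open>degree g = s\<close>, and \<open>polar_poly s g\<close> if
        infinity is a simple root. It divides a coefficient of degree at most \<open>s - 2\<close>,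
        which is therefore 0.\<close>
      from dg' show False
      proof
        assume ds: "degree g = s"
        obtain X Y where "X * ?D + Y * ?U = 1"
          using comaximal_if_no_common_root[OF D0 nocommon'] by blast
        then have "?D dvd A"
          using poly_dvd_cancel_comaximal dvd(1) by blast
        moreover have "degree ?D = s - 1"
          using ds by (simp add: degree_pderiv)
        ultimately have "A = 0"
          using AB(2) s dvd_imp_degree_le[of ?D A] by linarith
        then show False
          using AB D0 by simp
      next
        assume ds: "degree g = s - 1"
        obtain X Y where "X * ?U + Y * ?D = 1"
          using comaximal_if_no_common_root[OF U0[OF ds] nocommon] by blast
        then have "?U dvd B"
          using poly_dvd_cancel_comaximal dvd(2) by blast
        moreover have "s - 1 \<le> degree ?U"
        proof (rule le_degree)
          have "coeff g (s - 1) \<noteq> 0"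
            using ds g0 by (metis leading_coeff_0_iff)
          then show "coeff ?U (s - 1) \<noteq> 0"
            using s by (simp add: coeff_polar_poly of_nat_diff)
        qed
        ultimately have "B = 0"
          using AB(3) s dvd_imp_degree_le[of ?U B] by linarith
        then show False
          using AB U0[OF ds] by simp
      qed
    qed
  next
    assume nsq: "\<not> sqfree_form s g"
    show "\<exists>A B. (A \<noteq> 0 \<or> B \<noteq> 0) \<and> degree A \<le> s - 2 \<and> degree B \<le> s - 2 \<and> A * ?U + B * ?D = 0"
    proof (cases "g = 0")
      case True
      then show ?thesis
        by (intro exI[of _ 1] exI[of _ 0]) (simp add: polar_poly_def)
    next
      case g0: False
      show ?thesis
      \<comment> \<open>A multiple root at infinity lowers both derivatives to degree at most
        \<open>s - 2\<close>, so they serve as coefficients themselves. A finite double root is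
        cancelled from both first.\<close>
      proof (cases "degree g \<le> s - 2")
        case True
        have "?U \<noteq> 0"
        proof
          assume "?U = 0"
          then have "(of_nat s - of_nat (degree g)) * lead_coeff g = 0"
            using coeff_polar_poly[of s g "degree g"] by simp
          then show False
            using g0 True s by (auto simp flip: of_nat_diff)
        qed
        moreover have "degree ?U \<le> s - 2"
        proof (rule degree_le, intro allI impI)
          fix i assume "s - 2 < i"
          then show "coeff ?U i = 0"
            using True by (simp add: coeff_polar_poly coeff_eq_0)
        qed
        moreover have "degree ?D \<le> s - 2"
          using True degree_pderiv[of g] by linarith
        ultimately show ?thesis
          by (intro exI[of _ "?D"] exI[of _ "- ?U"]) (simp add: mult.commute)
      next
        case False
        then have "\<not> rsquarefree g"
          using nsq g0 dg by (auto simp: sqfree_form_def)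
        then obtain a where a: "poly g a = 0" "poly ?D a = 0"
          by (auto simp: rsquarefree_roots)
        then have "poly ?U a = 0"
          by (simp add: UD)
        then obtain U1 where U1: "?U = [:- a, 1:] * U1"
          by (auto simp: poly_eq_0_iff_dvd dvd_def)
        obtain D1 where D1: "?D = [:- a, 1:] * D1"
          using a(2) by (auto simp: poly_eq_0_iff_dvd dvd_def)
        have "?D \<noteq> 0"
        proof
          assume "?D = 0"
          then have "degree g = 0"
            by (simp add: pderiv_eq_0_iff)
          then show False
            using a(1) g0 by (auto elim!: degree_eq_zeroE)
        qed
        then have "D1 \<noteq> 0"
          using D1 by auto
        have "degree D1 \<le> s - 2"
        proof -
          have "degree ?D = Suc (degree D1)"
            using \<open>D1 \<noteq> 0\<close> by (simp add: D1 degree_mult_eq del: mult_pCons_left)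
          then show ?thesis
            using dg degree_pderiv[of g] by linarith
        qed
        moreover have "degree U1 \<le> s - 2"
        proof (cases "U1 = 0")
          case False
          then have "degree ?U = Suc (degree U1)"
            by (simp add: U1 degree_mult_eq del: mult_pCons_left)
          then show ?thesis
            using dU by linarith
        qed simp
        moreover have swap: "D * (p * U) + (- U) * (p * D) = 0" for D U p :: "'a poly"
          by (simp add: algebra_simps)
        have "D1 * ?U + (- U1) * ?D = 0"
          unfolding U1 D1 by (rule swap)
        ultimately show ?thesis
          using \<open>D1 \<noteq> 0\<close> by (metis degree_minus)
      qed
    qed
  qed
qed

section \<open>The locus of forms annihilated by a form with a double root\<close>

lemma coeff_poly_coeff: "degree g \<le> s \<Longrightarrow> coeff_poly s (coeff g) = g"
  by (rule poly_eqI) (auto simp: coeff_coeff_poly coeff_eq_0)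

text \<open>Either \<open>h\<close> has a double root at infinity when seen in degree
  \<open>s\<close>, or it has degree \<open>s - 1\<close> and one of its roots can be
  doubled.\<close>

lemma lower_degree_nonsqfree:
  fixes h :: "'a::{alg_closed_field,field_char_0} poly"
  assumes h: "apolar d b c h" "h \<noteq> 0" and "c < s" "s \<le> d" "2 \<le> s"
  obtains g where "apolar d b s g" "g \<noteq> 0" "\<not> sqfree_form s g"
proof (cases "degree h \<le> s - 2")
  case True
  have "apolar d b s (h * 1)"
    by (rule apolar_mult[OF h(1)]) (use assms in auto)
  moreover have "\<not> sqfree_form s h"
    using True \<open>2 \<le> s\<close> by (auto simp: sqfree_form_def)
  ultimately show ?thesis
    using that h(2) by simp
next
  case False
  then have dh: "degree h = s - 1" "c = s - 1"
    using h assms by (auto simp: apolar_def)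
  then obtain a where a: "poly h a = 0"
    using alg_closed_imp_poly_has_root[of h] \<open>2 \<le> s\<close> by auto
  have "apolar d b s (h * [:- a, 1:])"
    by (rule apolar_mult[OF h(1)]) (use assms dh in auto)
  moreover have "[:- a, 1:] ^ 2 dvd h * [:- a, 1:]"
    using a unfolding poly_eq_0_iff_dvd power2_eq_square by (rule mult_dvd_mono) simp
  then have "\<not> sqfree_form s (h * [:- a, 1:])"
    unfolding sqfree_form_def rsquarefree_roots by (metis double_root_iff)
  moreover have "h * [:- a, 1:] \<noteq> 0"
    using h(2) by (metis mult_eq_0_iff pCons_eq_0_iff zero_neq_one)
  ultimately show ?thesis
    using that by blast
qed

lemma sqfree_form_smult: "c \<noteq> 0 \<Longrightarrow> sqfree_form s (smult c (g :: 'a::field_char_0 poly)) \<longleftrightarrow> sqfree_form s g"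
  by (auto simp: sqfree_form_def rsquarefree_roots pderiv_smult)

text \<open>By \<open>lower_degree_nonsqfree\<close> an apolar form of lower degree would produce a
  nonsquarefree one, so \<open>g\<close> has least degree.\<close>

lemma unique_apolar:
  fixes g h :: "'a::{alg_closed_field,field_char_0} poly"
  assumes all: "\<And>g. apolar d b s g \<Longrightarrow> g \<noteq> 0 \<Longrightarrow> sqfree_form s g"
    and s: "2 \<le> s" "2 * s \<le> d + 1" and g: "apolar d b s g" "g \<noteq> 0" and h: "apolar d b s h"
  obtains c where "h = smult c g"
proof -
  have "s \<le> d"
    using g by (simp add: apolar_def)
  then have "min_apolar d b s g"
    unfolding min_apolar_def using g lower_degree_nonsqfree[OF _ _ _ _ s(1)] all by metis
  then show ?thesis
    using that min_apolar_unique[OF _ h s(2)] by blast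
qed

text \<open>If an apolar form exists at \<open>x0\<close>, its uniqueness lets Cramer's rule solve
  for it near \<open>x0\<close>; the equation is the discriminant of this solution times the
  determinant of the system.\<close>

lemma nonsqfree_equations:
  fixes x0 :: "nat \<Rightarrow> 'a::{alg_closed_field,field_char_0}"
  assumes s: "2 \<le> s" "2 * s \<le> d + 1"
    and x0: "\<And>g. apolar d (dual_coord d x0) s g \<Longrightarrow> g \<noteq> 0 \<Longrightarrow> sqfree_form s g"
  obtains e \<phi> where "hom_fun d e \<phi>" "\<phi> x0 \<noteq> 0"
    "\<And>x g. apolar d (dual_coord d x) s g \<Longrightarrow> g \<noteq> 0 \<Longrightarrow> \<not> sqfree_form s g \<Longrightarrow> \<phi> x = 0"
proof (cases "\<exists>g. apolar d (dual_coord d x0) s g \<and> g \<noteq> 0")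
  case False
  have "s \<le> d"
    using s by linarith
  moreover have "g = 0" if "apolar d (dual_coord d x0) s g" for g
    using False that by blast
  ultimately obtain e \<phi> where \<phi>: "hom_fun d e \<phi>" "\<phi> x0 \<noteq> 0"
    "\<And>x g. apolar d (dual_coord d x) s g \<Longrightarrow> \<phi> x \<noteq> 0 \<Longrightarrow> g = 0"
    using apolar_equations[of s d x0] by metis
  show ?thesis
    by (rule that[OF \<phi>(1,2)]) (use \<phi>(3) in blast)
next
  case True
  then obtain g0 where g0: "apolar d (dual_coord d x0) s g0" "g0 \<noteq> 0"
    by blast
  have sd: "s \<le> d" and dg0: "degree g0 \<le> s"
    using g0 by (auto simp: apolar_def)
  \<comment> \<open>A pivot: fixing the coefficient at \<open>j0\<close> selects one form on the
    line of solutions, and the Hankel matrix at \<open>x0\<close> is injective on vectors that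
    vanish there.\<close>
  define j0 where "j0 = degree g0"
  have j0: "j0 \<le> s" "coeff g0 j0 \<noteq> 0"
    using dg0 g0 by (auto simp: j0_def)
  define C where "C x i j = dual_coord d x (i + j)" for x :: "nat \<Rightarrow> 'a" and i j
  define J where "J = {..s} - {j0}"
  have inj: "v = (\<lambda>j. 0)"
    if v: "\<And>j. j \<notin> J \<Longrightarrow> v j = 0" "\<And>i. i < d - s + 1 \<Longrightarrow> (\<Sum>j<s + 1. C x0 i j * v j) = 0" for v
  proof -
    have "apolar d (dual_coord d x0) s (coeff_poly s v)"
      using v(2) sd by (simp only: apolar_coeff_poly C_def) blast
    then obtain c where c: "coeff_poly s v = smult c g0"
      using unique_apolar[OF x0 s g0] by blast
    have "v j0 = c * coeff g0 j0"
      using arg_cong[OF c, of "\<lambda>p. coeff p j0"] j0 by (simp add: coeff_coeff_poly)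
    then have "c = 0"
      using v(1)[of j0] j0 by (simp add: J_def)
    then have "coeff (coeff_poly s v) j = 0" for j
      using c by simp
    then have "v j = 0" if "j \<le> s" for j
      using that by (metis coeff_coeff_poly)
    then show ?thesis
      using v(1) by (metis Diff_iff J_def atMost_iff)
  qed
  obtain B where B: "\<And>v k. (\<And>j. j \<notin> J \<Longrightarrow> v j = 0) \<Longrightarrow>
      (\<Sum>i<d - s + 1. B k i * (\<Sum>j<s + 1. C x0 i j * v j)) = v k"
    by (rule left_inverse_matrix[where J = J and m = "d - s + 1" and n = "s + 1" and C = "C x0"])
       (use inj in blast)+
  \<comment> \<open>The row \<open>j0\<close> is a unit row that reads off the pivot; the other rows
    are those of the Hankel matrix after the left inverse. An apolar form is sent to its pivot
    coefficient times a unit vector.\<close>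
  define N where "N x = mat (s + 1) (s + 1) (\<lambda>(k, j). if k = j0 then (if j = j0 then 1 else 0)
     else \<Sum>i<d - s + 1. B k i * C x i j)" for x
  have N: "N x \<in> carrier_mat (s + 1) (s + 1)" for x
    by (simp add: N_def)
  have entry: "N x $$ (k, j) = (if k = j0 then (if j = j0 then 1 else 0)
     else \<Sum>i<d - s + 1. B k i * C x i j)" if "k < s + 1" "j < s + 1" for x k j
    using that by (simp add: N_def del: sum.lessThan_Suc)
  have Nv: "(\<Sum>j<s + 1. N x $$ (k, j) * v j) = (\<Sum>i<d - s + 1. B k i * (\<Sum>j<s + 1. C x i j * v j))"
    if "k < s + 1" "k \<noteq> j0" for x k v
    using that by (simp add: entry sum_mult_assoc del: sum.lessThan_Suc)
  have Nv0: "(\<Sum>j<s + 1. N x $$ (j0, j) * v j) = v j0" for x v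
  proof -
    have "(\<Sum>j<s + 1. N x $$ (j0, j) * v j) = (\<Sum>j<s + 1. if j = j0 then v j else 0)"
      using j0 by (intro sum.cong) (auto simp: entry)
    then show ?thesis
      using j0 by simp
  qed
  define w where "w x j = adj_mat (N x) $$ (j, j0)" for x j
  have Cramer: "det (N x) * v j = w x j * v j0"
    if v: "\<And>k. k < s + 1 \<Longrightarrow> k \<noteq> j0 \<Longrightarrow> (\<Sum>j<s + 1. N x $$ (k, j) * v j) = 0" and j: "j < s + 1" for x v j
  proof -
    have adj: "adj_mat (N x) \<in> carrier_mat (s + 1) (s + 1)"
      using adj_mat(1)[OF N] .
    have "(\<Sum>l<s + 1. adj_mat (N x) $$ (j, l) * N x $$ (l, i)) = (if j = i then det (N x) else 0)"
      if "i < s + 1" for i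
    proof -
      have "(adj_mat (N x) * N x) $$ (j, i) = (\<Sum>l<s + 1. adj_mat (N x) $$ (j, l) * N x $$ (l, i))"
        using that j adj N[of x] by (auto simp: times_mat_def scalar_prod_def atLeast0LessThan simp del: sum.lessThan_Suc)
      then show ?thesis
        using that j by (cases "j = i") (simp_all add: adj_mat(3)[OF N] del: sum.lessThan_Suc)
    qed
    then have "det (N x) * v j = (\<Sum>i<s + 1. (\<Sum>l<s + 1. adj_mat (N x) $$ (j, l) * N x $$ (l, i)) * v i)"
      using j by (simp add: if_distrib[of "\<lambda>x. x * _"] cong: if_cong del: sum.lessThan_Suc)
    also have "\<dots> = (\<Sum>l<s + 1. adj_mat (N x) $$ (j, l) * (\<Sum>i<s + 1. N x $$ (l, i) * v i))"
      by (rule sum_mult_assoc)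
    also have "\<dots> = (\<Sum>l<s + 1. if l = j0 then adj_mat (N x) $$ (j, j0) * v j0 else 0)"
      using v Nv0 by (intro sum.cong) (auto simp del: sum.lessThan_Suc)
    also have "\<dots> = w x j * v j0"
      using j0 by (simp add: w_def)
    finally show ?thesis .
  qed
  have kernel: "det (N x) * coeff g j = w x j * coeff g j0"
    if g: "apolar d (dual_coord d x) s g" and j: "j < s + 1" for x g j
  proof (rule Cramer[OF _ j])
    have "apolar d (dual_coord d x) s (coeff_poly s (coeff g))"
      using g by (subst coeff_poly_coeff) (auto simp: apolar_def)
    then have *: "(\<Sum>j<s + 1. C x i j * coeff g j) = 0" if "i < d - s + 1" for i
      using that by (simp only: apolar_coeff_poly[OF sd] C_def)
    show "(\<Sum>j<s + 1. N x $$ (k, j) * coeff g j) = 0" if "k < s + 1" "k \<noteq> j0" for k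
      unfolding Nv[OF that] using * by (intro sum.neutral) auto
  qed
  have det0: "det (N x0) \<noteq> 0"
  proof
    assume "det (N x0) = 0"
    then obtain c j where c: "j < s + 1" "c j \<noteq> 0" "\<And>k. k < s + 1 \<Longrightarrow> (\<Sum>j<s + 1. N x0 $$ (k, j) * c j) = 0"
      unfolding det_eq_0_iff_kernel[OF N] by blast
    have "c j0 = 0"
      using c(3)[of j0] Nv0[of x0 c] j0 by simp
    then have "j \<noteq> j0"
      using c by auto
    define v where "v j = (if j \<in> J then c j else 0)" for j
    have vc: "v j = c j" if "j < s + 1" for j
      using that \<open>c j0 = 0\<close> by (auto simp: v_def J_def)
    have "v j = (\<Sum>i<d - s + 1. B j i * (\<Sum>j<s + 1. C x0 i j * v j))"
      by (rule B[symmetric]) (simp add: v_def)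
    also have "\<dots> = (\<Sum>l<s + 1. N x0 $$ (j, l) * c l)"
      unfolding Nv[OF c(1) \<open>j \<noteq> j0\<close>, symmetric] using vc by (intro sum.cong) auto
    finally show False
      using c vc by simp
  qed
  \<comment> \<open>The factor \<open>det (N x)\<close> covers apolar forms whose pivot coefficient
    is 0, where \<open>w x\<close> need not be proportional to the form.\<close>
  define \<phi> where "\<phi> x = det (disc_mat s (coeff_poly s (w x))) * det (N x)" for x
  have row: "hom_fun d (if k = j0 then 0 else 1) (\<lambda>x. N x $$ (k, j))" if kj: "k < s + 1" "j < s + 1" for k j
  proof (cases "k = j0")
    case True
    then show ?thesis
      using kj by (simp add: entry hom_fun_const)
  next
    case False
    then have "(\<lambda>x. N x $$ (k, j)) = (\<lambda>x. \<Sum>i<d - s + 1. B k i * dual_coord d x (i + j))"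
      using kj by (simp add: entry C_def del: sum.lessThan_Suc)
    moreover have "i + j \<le> d" if "i < d - s + 1" for i
      using that kj sd by linarith
    ultimately show ?thesis
      using False by (simp only: if_False) (intro hom_fun_sum hom_fun_cmult hom_fun_dual_coord, simp)
  qed
  \<comment> \<open>Column \<open>j0\<close> of the adjugate consists of minors without row
    \<open>j0\<close>, the only row of degree 0, so all entries have degree
    \<open>s\<close>.\<close>
  have hom_w: "hom_fun d s (\<lambda>x. w x j)" if j: "j < s + 1" for j
  proof -
    have "hom_fun d (\<Sum>k<s. 1) (\<lambda>x. det (mat_delete (N x) j0 j))"
    proof (rule hom_fun_det)
      show "mat_delete (N x) j0 j \<in> carrier_mat s s" for x
        using mat_delete_carrier[OF N, of x j0 j] by simp
      fix k l assume kl: "k < s" "l < s"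
      define k' where "k' = (if k < j0 then k else Suc k)"
      define l' where "l' = (if l < j then l else Suc l)"
      have "mat_delete (N x) j0 j $$ (k, l) = N x $$ (k', l')" for x
        using kl N[of x] by (simp add: mat_delete_def k'_def l'_def)
      moreover have "k' < s + 1" "l' < s + 1" "k' \<noteq> j0"
        using kl by (auto simp: k'_def l'_def)
      ultimately show "hom_fun d 1 (\<lambda>x. mat_delete (N x) j0 j $$ (k, l))"
        using row[of k' l'] by simp
    qed
    moreover have "w x j = (- 1) ^ (j0 + j) * det (mat_delete (N x) j0 j)" for x
      using N[of x] j j0 by (simp add: w_def adj_mat_def cofactor_def)
    ultimately show ?thesis
      using hom_fun_cmult by simp
  qed
  have hom_coeff: "hom_fun d s (\<lambda>x. coeff (coeff_poly s (w x)) j)" for j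
    using hom_w[of j] by (cases "j \<le> s") (simp_all add: coeff_coeff_poly)
  have "hom_fun d (\<Sum>n<2 * (s - 1). s) (\<lambda>x. det (disc_mat s (coeff_poly s (w x))))"
  proof (rule hom_fun_det[OF disc_mat_carrier])
    fix n l assume "n < 2 * (s - 1)" "l < 2 * (s - 1)"
    moreover have "hom_fun d s (\<lambda>x. coeff (monom 1 a * polar_poly s (coeff_poly s (w x))) n)"
      "hom_fun d s (\<lambda>x. coeff (monom 1 a * pderiv (coeff_poly s (w x))) n)" for a
      by (cases "n < a"; simp add: coeff_monom_mult coeff_polar_poly coeff_pderiv hom_fun_cmult hom_coeff
          del: of_nat_Suc)+
    ultimately show "hom_fun d s (\<lambda>x. disc_mat s (coeff_poly s (w x)) $$ (n, l))"
      by (cases "l < s - 1") (simp_all add: disc_mat_def)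
  qed
  moreover have "hom_fun d (\<Sum>k<s + 1. if k = j0 then 0 else 1) (\<lambda>x. det (N x))"
    using row by (rule hom_fun_det[OF N])
  ultimately have "hom_fun d ((\<Sum>n<2 * (s - 1). s) + (\<Sum>k<s + 1. if k = j0 then 0 else 1)) \<phi>"
    unfolding \<phi>_def by (rule hom_fun_mult)
  moreover have "\<phi> x0 \<noteq> 0"
  proof -
    define c where "c = det (N x0) / coeff g0 j0"
    have "coeff_poly s (w x0) = smult c g0"
    proof (rule poly_eqI)
      fix j
      show "coeff (coeff_poly s (w x0)) j = coeff (smult c g0) j"
        using kernel[OF g0(1), of j] j0 dg0
        by (cases "j \<le> s") (auto simp: coeff_coeff_poly c_def field_simps coeff_eq_0)
    qed
    moreover have "c \<noteq> 0"
      using det0 j0 by (simp add: c_def)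
    ultimately have "sqfree_form s (coeff_poly s (w x0))"
      using x0[OF g0] by (simp add: sqfree_form_smult)
    then show ?thesis
      using det0 det_disc_mat[OF degree_coeff_poly s(1), of "w x0"] by (simp add: \<phi>_def)
  qed
  moreover have "\<phi> x = 0"
    if g: "apolar d (dual_coord d x) s g" "g \<noteq> 0" "\<not> sqfree_form s g" for x g
  proof (cases "coeff g j0 = 0")
    case True
    have "degree g < s + 1"
      using g by (simp add: apolar_def)
    then have "det (N x) * lead_coeff g = 0"
      using kernel[OF g(1) \<open>degree g < s + 1\<close>] True by simp
    then show ?thesis
      using g(2) by (simp add: \<phi>_def)
  next
    case False
    define c where "c = det (N x) / coeff g j0"
    have "degree g \<le> s"
      using g by (simp add: apolar_def)
    have eq: "coeff_poly s (w x) = smult c g"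
    proof (rule poly_eqI)
      fix j
      show "coeff (coeff_poly s (w x)) j = coeff (smult c g) j"
        using kernel[OF g(1), of j] False \<open>degree g \<le> s\<close>
        by (cases "j \<le> s") (auto simp: coeff_coeff_poly c_def field_simps coeff_eq_0)
    qed
    then have "\<not> sqfree_form s (coeff_poly s (w x))"
      using g(3) by (cases "c = 0") (auto simp: sqfree_form_smult, auto simp: sqfree_form_def)
    then show ?thesis
      using det_disc_mat[OF degree_coeff_poly s(1), of "w x"] by (simp add: \<phi>_def)
  qed
  ultimately show ?thesis
    by (rule that)
qed

section \<open>Density in the space of forms apolar to a given form\<close>

text \<open>
  The witness is, up to a factor, the residue of \<open>p / g\<close> at infinity, corrected by one further coefficient
  when \<open>g\<close> itself has a root at infinity.
\<close>

lemma residue_functional: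
  fixes g :: "'a::field poly"
  assumes g: "g \<noteq> 0" "degree g \<le> s" and s: "2 \<le> s" "2 * s \<le> d + 2"
  obtains c where "apolar d c s g" "\<And>h. apolar d c (s - 1) h \<Longrightarrow> h = 0"
proof -
  define j where "j = degree g"
  define m where "m = s - j"
  have jm: "j \<le> s" "j + m = s" "m \<le> s" "s \<le> d"
    using g s by (auto simp: j_def m_def)
  \<comment> \<open>For \<open>j = 0\<close> the remainder is 0, so the truncated
    \<open>j - 1\<close> is harmless. If \<open>m > 0\<close>, the products \<open>g * p\<close>
    with \<open>degree p \<le> d - s\<close> have degree at most \<open>d - m\<close>, and the
    coefficient just above vanishes on them.\<close>
  define \<mu> where "\<mu> p = coeff (p mod g) (j - 1) + (if m = 0 then 0 else coeff p (d - m + 1))" for p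
  define c where "c i = \<mu> (monom 1 i)" for i
  have lin: "\<mu> (p + q) = \<mu> p + \<mu> q" "\<mu> (smult a p) = a * \<mu> p" "\<mu> 0 = 0" for p q a
    by (simp_all add: \<mu>_def poly_mod_add_left mod_smult_left algebra_simps)
  have lin_sum: "\<mu> (\<Sum>i\<in>A. f i) = (\<Sum>i\<in>A. \<mu> (f i))" for A :: "nat set" and f
    by (induction A rule: infinite_finite_induct) (auto simp: lin)
  have pair: "pairing c p = \<mu> p" for p
  proof -
    have "\<mu> p = \<mu> (\<Sum>i\<le>degree p. smult (coeff p i) (monom 1 i))"
      by (simp add: smult_monom poly_as_sum_of_monoms)
    then show ?thesis
      by (simp add: lin_sum lin pairing_def c_def)
  qed
  have "apolar d c s g"
    unfolding apolar_def
  proof (intro conjI allI impI)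
    fix p :: "'a poly" assume p: "degree p \<le> d - s"
    have "m \<noteq> 0 \<Longrightarrow> coeff (g * p) (d - m + 1) = 0"
      using degree_mult_le[of g p] p jm by (intro coeff_eq_0) (simp flip: j_def)
    then show "pairing c (g * p) = 0"
      by (simp add: pair \<mu>_def)
  qed (use g jm in auto)
  moreover have "h = 0" if h: "apolar d c (s - 1) h" for h
  proof (rule ccontr)
    assume h0: "h \<noteq> 0"
    define e where "e = degree h"
    have e: "e \<le> s - 1"
      using h by (simp add: apolar_def e_def)
    have van: "\<mu> (h * p) = 0" if "degree p \<le> d - (s - 1)" for p
      using h that by (simp add: apolar_def pair)
    have lead: "coeff (h * monom 1 n) (e + n) = lead_coeff h" for n
      using coeff_monom_mult[of 1 n h "e + n"] by (simp add: e_def mult.commute)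
    have deg: "degree (h * monom 1 n) = e + n" for n
      using h0 by (simp add: degree_mult_eq degree_monom_eq e_def monom_eq_0_iff)
    show False
    proof (cases "e < j")
      case True
      \<comment> \<open>\<open>h * p\<close> has degree \<open>j - 1\<close>: it is its own
        remainder, and the functional returns the leading coefficient of \<open>h\<close>.\<close>
      define p where "p = monom (1::'a) (j - 1 - e)"
      have "degree p \<le> d - (s - 1)"
        using jm s e by (simp add: p_def degree_monom_eq)
      moreover have dp: "degree (h * p) = j - 1"
        using deg[of "j - 1 - e"] True by (simp add: p_def)
      moreover have "(h * p) mod g = h * p"
        using dp True by (intro mod_poly_less) (simp add: j_def)
      moreover have "coeff (h * p) (d - m + 1) = 0"
        using dp True jm by (intro coeff_eq_0) linarith
      moreover have "coeff (h * p) (j - 1) = lead_coeff h"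
        using lead[of "j - 1 - e"] True by (simp add: p_def)
      ultimately show False
        using van[of p] h0 by (auto simp: \<mu>_def split: if_splits)
    next
      case False
      \<comment> \<open>The factor \<open>g\<close> kills the remainder, and the monomial brings
        \<open>h * p\<close> to degree \<open>d - m + 1\<close>, where the second summand sees the
        leading coefficient. Here \<open>m > 0\<close> because
        \<open>j \<le> e \<le> s - 1\<close>.\<close>
      define p where "p = g * monom 1 (d + 1 - s - e)"
      have n: "e + j + (d + 1 - s - e) = d - m + 1" "m \<noteq> 0"
        using jm s e False by auto
      have "degree p = j + (d + 1 - s - e)"
        using g by (simp add: p_def degree_mult_eq degree_monom_eq monom_eq_0_iff j_def)
      then have "degree p \<le> d - (s - 1)"
        using jm s e False by linarith
      then have "\<mu> (h * p) = 0"
        by (rule van)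
      moreover have "(h * p) mod g = 0"
        by (simp add: p_def mod_eq_0_iff_dvd)
      moreover have "coeff (h * p) (d - m + 1) = lead_coeff h * lead_coeff g"
      proof -
        have "h * p = monom 1 (d + 1 - s - e) * (h * g)"
          by (simp add: p_def mult_ac)
        moreover have "coeff (monom 1 k * (h * g)) (e + j + k) = coeff (h * g) (e + j)" for k
          by (simp add: coeff_monom_mult)
        ultimately have "coeff (h * p) (e + j + (d + 1 - s - e)) = coeff (h * g) (e + j)"
          by (simp only:)
        then show ?thesis
          using n by (simp add: coeff_degree_mult e_def j_def coeff_mult_degree_sum)
      qed
      ultimately show False
        using h0 g n by (simp add: \<mu>_def)
    qed
  qed
  ultimately show ?thesis
    by (rule that)
qed

lemma apolar_cong:
  assumes "\<And>i. i \<le> d \<Longrightarrow> a i = b i"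
  shows "apolar d a r h \<longleftrightarrow> apolar d b r h"
proof -
  have "a (i + j) = b (i + j)" if "i \<le> d - r" "j \<le> r" "r \<le> d" for i j
    using that assms by simp
  then show ?thesis
    by (auto simp: apolar_monom_iff pairing_mult_monom)
qed

lemma dual_coord_line:
  "dual_coord d (\<lambda>i. (1 - t) * x i + t * y i) i = (1 - t) * dual_coord d x i + t * dual_coord d y i"
  by (simp add: dual_coord_def add_divide_distrib)

text \<open>\<open>x\<close> is joined by a line to the point \<open>y\<close> of the residue
  functional. All its points are apolar to \<open>g\<close>, and the condition in degree
  \<open>s - 1\<close> holds where a polynomial that is nonzero at \<open>t = 1\<close> does not
  vanish. So \<open>\<psi>\<close> vanishes on the whole line, in particular at
  \<open>t = 0\<close>.\<close>

lemma nonsqfree_density: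
  fixes x :: "nat \<Rightarrow> 'a::field_char_0"
  assumes s: "2 \<le> s" "2 * s \<le> d + 2"
    and g: "apolar d (dual_coord d x) s g" "g \<noteq> 0"
    and P: "hom_fun d e \<psi>"
    and van: "\<And>y. apolar d (dual_coord d y) s g \<Longrightarrow> (\<And>h. apolar d (dual_coord d y) (s - 1) h \<Longrightarrow> h = 0) \<Longrightarrow> \<psi> y = 0"
  shows "\<psi> x = 0"
proof -
  have dg: "degree g \<le> s" and sd: "s - 1 \<le> d"
    using g by (auto simp: apolar_def)
  obtain c where c: "apolar d c s g" "\<And>h. apolar d c (s - 1) h \<Longrightarrow> h = 0"
    using residue_functional[OF g(2) dg s] by blast
  define y where "y i = of_nat (d choose i) * c i" for i
  have "dual_coord d y i = c i" if "i \<le> d" for i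
    using that by (simp add: y_def dual_coord_def)
  then have yc: "apolar d (dual_coord d y) r h \<longleftrightarrow> apolar d c r h" for r h
    by (rule apolar_cong)
  obtain e' \<phi> where \<phi>: "hom_fun d e' \<phi>" "\<phi> y \<noteq> 0"
    "\<And>x g. apolar d (dual_coord d x) (s - 1) g \<Longrightarrow> \<phi> x \<noteq> 0 \<Longrightarrow> g = 0"
    using apolar_equations[OF sd, of y] c(2) yc by metis
  define z where "z t = (\<lambda>i. (1 - t) * x i + t * y i)" for t
  obtain Q where Q: "\<And>t. \<psi> (z t) = poly Q t"
    using hom_fun_line[OF P] unfolding z_def by blast
  obtain R where R: "\<And>t. \<phi> (z t) = poly R t"
    using hom_fun_line[OF \<phi>(1)] unfolding z_def by blast
  have gz: "apolar d (dual_coord d (z t)) s g" for t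
  proof -
    have "pairing (dual_coord d (z t)) p = (1 - t) * pairing (dual_coord d x) p + t * pairing (dual_coord d y) p" for p
      by (simp add: z_def dual_coord_line pairing_def distrib_left sum.distrib sum_distrib_left mult.left_commute)
    then show ?thesis
      using g(1) yc[of s g] c(1) by (simp add: apolar_def)
  qed
  have "poly (Q * R) t = 0" for t
  proof (cases "\<phi> (z t) = 0")
    case False
    then have "\<psi> (z t) = 0"
      using \<phi>(3) gz by (intro van) blast+
    then show ?thesis
      by (simp add: Q)
  qed (simp add: R)
  then have "Q * R = 0"
    using poly_all_0_iff_0 by blast
  moreover have "R \<noteq> 0"
    using R[of 1] \<phi>(2) by (auto simp: z_def)
  ultimately have "Q = 0"
    by simp
  then show ?thesis
    using Q[of 0] by (simp add: z_def)
qed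

section \<open>Forms and their coordinates\<close>

definition form_of :: "nat \<Rightarrow> (nat \<Rightarrow> 'a::field) \<Rightarrow> 'a poly poly" where
  "form_of d x = (\<Sum>i\<le>d. monom (monom (x i) (d - i)) i)"

lemma coeff_form_of: "coeff (coeff (form_of d x) j) i = (if i + j = d then x j else 0)"
proof -
  have "coeff (coeff (form_of d x) j) i = (\<Sum>k\<le>d. if k = j then coeff (monom (x k) (d - k)) i else 0)"
    by (simp add: form_of_def coeff_sum if_distrib[of "\<lambda>p. coeff p i"] cong: if_cong)
  also have "\<dots> = (if i + j = d then x j else 0)"
    by auto
  finally show ?thesis .
qed

lemma form_of_in_binary_forms: "form_of d x \<in> binary_forms d"
  by (auto simp: binary_forms_def coeff_form_of split: if_splits)

lemma form_coord_form_of: "i \<le> d \<Longrightarrow> form_coord d (form_of d x) i = x i"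
  by (simp add: form_coord_def coeff_form_of)

lemma form_of_form_coord: "f \<in> binary_forms d \<Longrightarrow> form_of d (form_coord d f) = f"
  by (auto simp: poly_eq_iff coeff_form_of form_coord_def binary_forms_def)

lemma form_of_cong: "(\<And>i. i \<le> d \<Longrightarrow> x i = y i) \<Longrightarrow> form_of d x = form_of d y"
  by (simp add: form_of_def)

lemma linear_form_power:
  "[:[:0, \<alpha>:], [:\<beta>:]:] ^ d = form_of d (\<lambda>i. of_nat (d choose i) * (\<alpha> ^ (d - i) * \<beta> ^ i))"
proof -
  have "[:[:0, \<alpha>:], [:\<beta>:]:] = monom [:\<beta>:] 1 + monom (monom \<alpha> 1) 0"
    by (simp add: monom_altdef)
  then have "[:[:0, \<alpha>:], [:\<beta>:]:] ^ d = (\<Sum>i\<le>d. of_nat (d choose i) * monom [:\<beta>:] 1 ^ i * monom (monom \<alpha> 1) 0 ^ (d - i))"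
    by (simp only: binomial_ring)
  also have "\<dots> = form_of d (\<lambda>i. of_nat (d choose i) * (\<alpha> ^ (d - i) * \<beta> ^ i))"
    unfolding form_of_def
  proof (rule sum.cong[OF refl])
    fix i
    have "[:\<beta>:] = monom \<beta> 0"
      by (simp add: monom_0)
    moreover have "(of_nat (d choose i) :: 'a poly poly) = monom (monom (of_nat (d choose i)) 0) 0"
      by (simp add: monom_0 of_nat_poly)
    ultimately show "of_nat (d choose i) * monom [:\<beta>:] 1 ^ i * monom (monom \<alpha> 1) 0 ^ (d - i) =
        monom (monom (of_nat (d choose i) * (\<alpha> ^ (d - i) * \<beta> ^ i)) (d - i)) i"
      by (simp add: monom_power mult_monom mult_ac)
  qed
  finally show ?thesis .
qed

lemma linear_form_iff: "l \<in> binary_forms 1 \<longleftrightarrow> (\<exists>\<alpha> \<beta>. l = [:[:0, \<alpha>:], [:\<beta>:]:])"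
proof
  assume "l \<in> binary_forms 1"
  then have "l = form_of 1 (form_coord 1 l)"
    by (simp add: form_of_form_coord)
  also have "\<dots> = [:[:0, form_coord 1 l 0:], [:form_coord 1 l 1:]:]"
    by (simp add: form_of_def monom_altdef)
  finally show "\<exists>\<alpha> \<beta>. l = [:[:0, \<alpha>:], [:\<beta>:]:]"
    by blast
next
  assume "\<exists>\<alpha> \<beta>. l = [:[:0, \<alpha>:], [:\<beta>:]:]"
  then obtain \<alpha> \<beta> where l: "l = [:[:0, \<alpha>:], [:\<beta>:]:] ^ 1"
    by auto
  show "l \<in> binary_forms 1"
    unfolding l linear_form_power by (rule form_of_in_binary_forms)
qed

lemma form_of_sum: "form_of d (\<lambda>i. \<Sum>j\<in>J. x j i) = (\<Sum>j\<in>J. form_of d (x j))"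
  by (auto simp: poly_eq_iff coeff_sum coeff_form_of)

lemma power_sum_iff:
  fixes f :: "'a::field_char_0 poly poly"
  assumes f: "f \<in> binary_forms d"
  shows "(\<exists>l. (\<forall>i<r. l i \<in> binary_forms 1) \<and> f = (\<Sum>i<r. l i ^ d)) \<longleftrightarrow>
    power_sum_rep d (dual_coord d (form_coord d f)) r"
proof -
  define y where "y \<alpha> \<beta> i = (\<Sum>j<r. of_nat (d choose i) * (\<alpha> j ^ (d - i) * \<beta> j ^ i))" for \<alpha> \<beta> :: "nat \<Rightarrow> 'a" and i
  have sum: "(\<Sum>j<r. [:[:0, \<alpha> j:], [:\<beta> j:]:] ^ d) = form_of d (y \<alpha> \<beta>)" for \<alpha> \<beta>
    unfolding y_def form_of_sum linear_form_power ..
  have iff: "f = form_of d (y \<alpha> \<beta>) \<longleftrightarrow>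
      (\<forall>i\<le>d. dual_coord d (form_coord d f) i = (\<Sum>j<r. \<alpha> j ^ (d - i) * \<beta> j ^ i))" for \<alpha> \<beta>
  proof -
    have "f = form_of d (y \<alpha> \<beta>) \<longleftrightarrow> (\<forall>i\<le>d. form_coord d f i = y \<alpha> \<beta> i)"
      by (metis f form_of_form_coord form_of_cong form_coord_form_of)
    also have "\<dots> \<longleftrightarrow> (\<forall>i\<le>d. dual_coord d (form_coord d f) i = (\<Sum>j<r. \<alpha> j ^ (d - i) * \<beta> j ^ i))"
      by (auto simp: y_def dual_coord_def field_simps simp flip: sum_distrib_left)
    finally show ?thesis .
  qed
  show ?thesis
  proof
    assume "\<exists>l. (\<forall>i<r. l i \<in> binary_forms 1) \<and> f = (\<Sum>i<r. l i ^ d)"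
    then obtain l where l: "\<forall>i<r. l i \<in> binary_forms 1" and fl: "f = (\<Sum>i<r. l i ^ d)"
      by blast
    obtain \<alpha> \<beta> where \<alpha>: "\<And>i. i < r \<Longrightarrow> l i = [:[:0, \<alpha> i:], [:\<beta> i:]:]"
      using l unfolding linear_form_iff by metis
    then have "f = form_of d (y \<alpha> \<beta>)"
      using fl by (simp flip: sum)
    then show "power_sum_rep d (dual_coord d (form_coord d f)) r"
      unfolding iff power_sum_rep_def by blast
  next
    assume "power_sum_rep d (dual_coord d (form_coord d f)) r"
    then obtain \<alpha> \<beta> where "f = form_of d (y \<alpha> \<beta>)"
      unfolding iff power_sum_rep_def by blast
    then show "\<exists>l. (\<forall>i<r. l i \<in> binary_forms 1) \<and> f = (\<Sum>i<r. l i ^ d)"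
      unfolding linear_form_iff by (intro exI[of _ "\<lambda>j. [:[:0, \<alpha> j:], [:\<beta> j:]:]"]) (auto simp: sum)
  qed
qed

lemma waring_rank_eq_Least:
  fixes f :: "'a::field_char_0 poly poly"
  assumes "f \<in> binary_forms d"
  shows "waring_rank d f = (LEAST r. power_sum_rep d (dual_coord d (form_coord d f)) r)"
  unfolding waring_rank_def power_sum_iff[OF assms] ..

text \<open>A \<open>d\<close>-th root of the scalar is moved into the linear forms.\<close>

lemma waring_rank_proportional:
  fixes f :: "'a::{alg_closed_field,field_char_0} poly poly"
  assumes "(f, g) \<in> proportional d" "0 < d"
  shows "waring_rank d g = waring_rank d f"
proof -
  have mono: "power_sum_rep d (dual_coord d (form_coord d g)) r"
    if fg: "(f, g) \<in> proportional d" and rep: "power_sum_rep d (dual_coord d (form_coord d f)) r" for f g :: "'a poly poly" and r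
  proof -
    obtain c where c: "g = smult [:c:] f"
      using fg unfolding proportional_def by blast
    obtain \<gamma> where \<gamma>: "\<gamma> ^ d = c"
      using nth_root_exists[OF assms(2)] by blast
    obtain \<alpha> \<beta> where ab: "\<And>i. i \<le> d \<Longrightarrow> dual_coord d (form_coord d f) i = (\<Sum>j<r. \<alpha> j ^ (d - i) * \<beta> j ^ i)"
      using rep unfolding power_sum_rep_def by blast
    have eq: "dual_coord d (form_coord d g) i = (\<Sum>j<r. (\<gamma> * \<alpha> j) ^ (d - i) * (\<gamma> * \<beta> j) ^ i)" if i: "i \<le> d" for i
    proof -
      have "dual_coord d (form_coord d g) i = c * dual_coord d (form_coord d f) i"
        by (simp add: c dual_coord_def form_coord_def)
      also have "\<dots> = (\<Sum>j<r. \<gamma> ^ (d - i) * \<gamma> ^ i * (\<alpha> j ^ (d - i) * \<beta> j ^ i))"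
        using i by (simp add: ab sum_distrib_left \<gamma> flip: power_add)
      finally show ?thesis
        by (simp add: power_mult_distrib mult_ac)
    qed
    show ?thesis
      unfolding power_sum_rep_def
      by (intro exI[of _ "\<lambda>j. \<gamma> * \<alpha> j"] exI[of _ "\<lambda>j. \<gamma> * \<beta> j"] allI impI eq)
  qed
  have "(g, f) \<in> proportional d"
    using assms(1) equiv_proportional[of d] by (meson equivE symE)
  then have "power_sum_rep d (dual_coord d (form_coord d g)) = power_sum_rep d (dual_coord d (form_coord d f))"
    using mono assms(1) by blast
  moreover have "f \<in> binary_forms d" "g \<in> binary_forms d"
    using assms(1) by (auto simp: proportional_def)
  ultimately show ?thesis
    by (simp add: waring_rank_eq_Least)
qed

definition nonsqfree_locus :: "nat \<Rightarrow> nat \<Rightarrow> (nat \<Rightarrow> 'a::field_char_0) set" where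
  "nonsqfree_locus d s = {x. \<exists>g. apolar d (dual_coord d x) s g \<and> g \<noteq> 0 \<and> \<not> sqfree_form s g}"

text \<open>All is read off from the least apolar degree \<open>t\<close>. For
  \<open>t < n + 2\<close> the rank is at most \<open>n + 1\<close> or larger than
  \<open>d - n\<close>; for \<open>t = n + 2\<close> with a double root it is \<open>d - n\<close>;
  every other form has rank strictly between \<open>n + 1\<close> and \<open>d - n\<close>.\<close>

lemma rank_iff_nonsqfree_locus:
  fixes f :: "'a::{alg_closed_field,field_char_0} poly poly"
  assumes f: "f \<in> binary_forms d" "f \<noteq> 0" and n: "2 * n + 3 \<le> d"
  defines "x \<equiv> form_coord d f"
  shows "x \<in> nonsqfree_locus d (n + 2) \<longleftrightarrow>
      1 \<le> waring_rank d f \<and> waring_rank d f \<le> n + 1 \<or> d - n \<le> waring_rank d f \<and> waring_rank d f \<le> d"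
      (is "?L \<longleftrightarrow> ?R")
    and "waring_rank d f \<le> d"
    and "waring_rank d f = d - n \<longleftrightarrow>
      x \<in> nonsqfree_locus d (n + 2) \<and> (\<forall>h. apolar d (dual_coord d x) (n + 1) h \<longrightarrow> h = 0)"
proof -
  define b where "b = dual_coord d x"
  have "\<exists>i\<le>d. x i \<noteq> 0"
  proof (rule ccontr)
    assume "\<not> (\<exists>i\<le>d. x i \<noteq> 0)"
    then have "form_of d x = 0"
      by (simp add: form_of_def)
    then show False
      using f by (simp add: x_def form_of_form_coord)
  qed
  then obtain i where "i \<le> d" "b i \<noteq> 0"
    by (auto simp: b_def dual_coord_def)
  then obtain t g where g: "min_apolar d b t g" and t: "1 \<le> t" "2 * t \<le> d + 2"
    using min_apolar_exists[of i d b] n by auto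
  define \<rho> where "\<rho> = (if sqfree_form t g then t else d + 2 - t)"
  have "0 < d"
    using n by simp
  note syl = sylvester[OF g t \<open>0 < d\<close>, folded \<rho>_def]
  have rank: "waring_rank d f = \<rho>"
    unfolding waring_rank_eq_Least[OF f(1)] using syl(1,2)
    by (intro Least_equality) (auto simp: b_def x_def not_less[symmetric])
  have g': "apolar d b t g" "g \<noteq> 0" "degree g \<le> t" "t \<le> d"
    using g by (auto simp: min_apolar_def apolar_def)
  have L: "?L \<longleftrightarrow> t < n + 2 \<or> t = n + 2 \<and> \<not> sqfree_form t g"
  proof
    assume ?L
    then obtain h where h: "apolar d b (n + 2) h" "h \<noteq> 0" "\<not> sqfree_form (n + 2) h"
      by (auto simp: nonsqfree_locus_def b_def)
    have "t \<le> n + 2"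
      using g h unfolding min_apolar_def by (meson not_less)
    moreover have "\<not> sqfree_form t g" if tn: "t = n + 2"
    proof -
      obtain c where c: "h = smult c g"
        using min_apolar_unique[OF g, of h] h(1) tn n by auto
      then have "c \<noteq> 0"
        using h by auto
      then show ?thesis
        using h c tn by (simp add: sqfree_form_smult)
    qed
    ultimately show "t < n + 2 \<or> t = n + 2 \<and> \<not> sqfree_form t g"
      by linarith
  next
    assume "t < n + 2 \<or> t = n + 2 \<and> \<not> sqfree_form t g"
    then show ?L
    proof
      assume "t < n + 2"
      moreover have "n + 2 \<le> d" "2 \<le> n + 2"
        using n by auto
      ultimately show ?L
        by (rule lower_degree_nonsqfree[OF g'(1,2)]) (auto simp: nonsqfree_locus_def b_def)
    next
      assume "t = n + 2 \<and> \<not> sqfree_form t g"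
      then show ?L
        using g' by (auto simp: nonsqfree_locus_def b_def)
    qed
  qed
  show "?L \<longleftrightarrow> ?R"
    unfolding L rank using t g' syl(3) n by (auto simp: \<rho>_def)
  show "waring_rank d f \<le> d"
    unfolding rank by (rule syl(3))
  have ann: "(\<forall>h. apolar d b (n + 1) h \<longrightarrow> h = 0) \<longleftrightarrow> n + 2 \<le> t"
  proof
    assume *: "\<forall>h. apolar d b (n + 1) h \<longrightarrow> h = 0"
    show "n + 2 \<le> t"
    proof (rule ccontr)
      assume "\<not> n + 2 \<le> t"
      then have "apolar d b (n + 1) (g * 1)"
        using n by (intro apolar_mult[OF g'(1)]) auto
      then show False
        using * g' by simp
    qed
  next
    assume "n + 2 \<le> t"
    then have "n + 1 < t"
      by simp
    then show "\<forall>h. apolar d b (n + 1) h \<longrightarrow> h = 0"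
      using g unfolding min_apolar_def by (elim conjE) (drule spec[of _ "n + 1"], simp)
  qed
  show "waring_rank d f = d - n \<longleftrightarrow>
      x \<in> nonsqfree_locus d (n + 2) \<and> (\<forall>h. apolar d (dual_coord d x) (n + 1) h \<longrightarrow> h = 0)"
    unfolding L rank b_def[symmetric] ann using t g' syl(3) n by (auto simp: \<rho>_def)
qed

section \<open>The closure of a stratum\<close>

definition form_class :: "nat \<Rightarrow> 'a::field poly poly \<Rightarrow> 'a poly poly set" where
  "form_class d f = proportional d `` {f}"

lemma proj_forms_iff: "p \<in> proj_forms d \<longleftrightarrow> (\<exists>f\<in>binary_forms d - {0}. p = form_class d f)"
  by (auto simp: proj_forms_def quotient_def form_class_def)

lemma form_class_self: "f \<in> binary_forms d \<Longrightarrow> f \<noteq> 0 \<Longrightarrow> f \<in> form_class d f"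
  unfolding form_class_def using equiv_class_self[OF equiv_proportional] by blast

lemma form_class_eq_iff:
  "f \<in> binary_forms d \<Longrightarrow> f \<noteq> 0 \<Longrightarrow> form_class d f = form_class d g \<Longrightarrow> (g, f) \<in> proportional d"
  using form_class_self[of f d] by (auto simp: form_class_def)

lemma mpoly_eval_class:
  assumes "P \<in> homogeneous_polys d" "h \<in> form_class d f"
  shows "mpoly_eval P (form_coord d h) = 0 \<longleftrightarrow> mpoly_eval P (form_coord d f) = 0"
  using mpoly_eval_proportional assms by (auto simp: form_class_def)

lemma homogeneous_imp_hom_fun:
  assumes "P \<in> homogeneous_polys d"
  obtains e where "hom_fun d e (mpoly_eval P)"
  using assms unfolding homogeneous_polys_def hom_fun_def by blast

lemma mpoly_eval_cong:
  assumes "P \<in> homogeneous_polys d" "\<And>i. i \<le> d \<Longrightarrow> x i = y i"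
  shows "mpoly_eval P x = mpoly_eval P y"
proof -
  have "monom_eval m x = monom_eval m y" if "m \<in> Poly_Mapping.keys P" for m
    unfolding monom_eval_def
  proof (rule prod.cong[OF refl])
    fix i assume "i \<in> Poly_Mapping.keys m"
    then have "i \<le> d"
      using assms(1) that by (auto simp: homogeneous_polys_def)
    then show "x i ^ Poly_Mapping.lookup m i = y i ^ Poly_Mapping.lookup m i"
      by (simp add: assms(2))
  qed
  then show ?thesis
    by (simp add: mpoly_eval_def)
qed

definition locus_classes :: "nat \<Rightarrow> nat \<Rightarrow> 'a::field_char_0 poly poly set set" where
  "locus_classes d s = {form_class d f | f. f \<in> binary_forms d \<and> f \<noteq> 0 \<and> form_coord d f \<in> nonsqfree_locus d s}"

text \<open>\<open>F\<close> consists of all equations of the locus;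
  \<open>nonsqfree_equations\<close> provides one that excludes a given point outside.\<close>

lemma closedin_locus:
  assumes s: "2 \<le> s" "2 * s \<le> d + 1"
  shows "closedin (zariski_topology d) (locus_classes d s :: 'a::{alg_closed_field,field_char_0} poly poly set set)"
proof -
  define F :: "'a mpolynomial set" where
    "F = {P \<in> homogeneous_polys d. \<forall>p\<in>locus_classes d s. \<forall>f\<in>p. mpoly_eval P (form_coord d f) = 0}"
  have "p \<in> locus_classes d s" if p: "p \<in> proj_zeros d F" for p
  proof (rule ccontr)
    assume np: "p \<notin> locus_classes d s"
    obtain f where f: "f \<in> binary_forms d" "f \<noteq> 0" "p = form_class d f"
      using p by (auto simp: proj_zeros_def proj_forms_iff)
    then have "form_coord d f \<notin> nonsqfree_locus d s"
      using np by (auto simp: locus_classes_def)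
    then have "\<And>g. apolar d (dual_coord d (form_coord d f)) s g \<Longrightarrow> g \<noteq> 0 \<Longrightarrow> sqfree_form s g"
      by (auto simp: nonsqfree_locus_def)
    then obtain e \<phi> where \<phi>: "hom_fun d e \<phi>" "\<phi> (form_coord d f) \<noteq> 0"
      "\<And>x g. apolar d (dual_coord d x) s g \<Longrightarrow> g \<noteq> 0 \<Longrightarrow> \<not> sqfree_form s g \<Longrightarrow> \<phi> x = 0"
      using nonsqfree_equations[OF s] by metis
    obtain P where P: "P \<in> homogeneous_polys d" "\<And>x. mpoly_eval P x = \<phi> x"
      using hom_fun_imp_homogeneous[OF \<phi>(1)] by blast
    have "mpoly_eval P (form_coord d h) = 0" if q: "q \<in> locus_classes d s" and hq: "h \<in> q" for q h
    proof -
      obtain f' where f': "q = form_class d f'" "form_coord d f' \<in> nonsqfree_locus d s"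
        using q unfolding locus_classes_def by blast
      then have "mpoly_eval P (form_coord d f') = 0"
        using \<phi>(3) by (auto simp: P nonsqfree_locus_def)
      then show ?thesis
        using mpoly_eval_class[OF P(1)] f' hq by blast
    qed
    then have "P \<in> F"
      using P(1) by (auto simp: F_def)
    then have "\<phi> (form_coord d f) = 0"
      using p f form_class_self[OF f(1,2)] by (auto simp: proj_zeros_def P)
    then show False
      using \<phi>(2) by simp
  qed
  moreover have "locus_classes d s \<subseteq> proj_zeros d F"
    by (auto simp: proj_zeros_def F_def proj_forms_iff locus_classes_def)
  ultimately have "locus_classes d s = proj_zeros d F"
    by blast
  moreover have "F \<subseteq> homogeneous_polys d"
    by (auto simp: F_def)
  ultimately show ?thesis
    unfolding closedin_zariski by (intro exI[of _ F] conjI)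
qed

lemma closure_stratum:
  assumes n: "2 * n + 3 \<le> d"
  shows "zariski_topology d closure_of waring_stratum d (int d - int n) =
    (locus_classes d (n + 2) :: 'a::{alg_closed_field,field_char_0} poly poly set set)"
proof (rule closure_of_unique)
  have stratum: "p \<in> waring_stratum d (int d - int n) \<longleftrightarrow>
      (\<exists>f. p = form_class d f \<and> f \<in> binary_forms d \<and> f \<noteq> 0 \<and> waring_rank d f = d - n)" for p :: "'a poly poly set"
    using n by (auto simp: waring_stratum_def form_class_def)
  show "waring_stratum d (int d - int n) \<subseteq> (locus_classes d (n + 2) :: 'a poly poly set set)"
    using rank_iff_nonsqfree_locus(3)[OF _ _ n] unfolding stratum locus_classes_def subset_iff mem_Collect_eq by metis
  show "closedin (zariski_topology d) (locus_classes d (n + 2) :: 'a poly poly set set)"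
    using n by (intro closedin_locus) auto
  fix T :: "'a poly poly set set"
  assume sub: "waring_stratum d (int d - int n) \<subseteq> T" and "closedin (zariski_topology d) T"
  then obtain F where F: "F \<subseteq> homogeneous_polys d" "T = proj_zeros d F"
    unfolding closedin_zariski by blast
  show "locus_classes d (n + 2) \<subseteq> T"
  proof
    fix p :: "'a poly poly set" assume "p \<in> locus_classes d (n + 2)"
    then obtain f g where f: "p = form_class d f" "f \<in> binary_forms d" "f \<noteq> 0"
      and g: "apolar d (dual_coord d (form_coord d f)) (n + 2) g" "g \<noteq> 0" "\<not> sqfree_form (n + 2) g"
      by (auto simp: locus_classes_def nonsqfree_locus_def)
    have "mpoly_eval P (form_coord d f) = 0" if P: "P \<in> F" for P
    proof -
      have Ph: "P \<in> homogeneous_polys d"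
        using F P by blast
      then obtain e where e: "hom_fun d e (mpoly_eval P)"
        using homogeneous_imp_hom_fun by blast
      show ?thesis
      \<comment> \<open>Points apolar to the same \<open>g\<close> without apolar form of degree
        \<open>n + 1\<close> have rank \<open>d - n\<close>, since \<open>g\<close> is not
        squarefree; on their classes \<open>P\<close> vanishes.\<close>
      proof (rule nonsqfree_density[OF _ _ g(1,2) e])
        fix y assume y: "apolar d (dual_coord d y) (n + 2) g"
          "\<And>h. apolar d (dual_coord d y) (n + 2 - 1) h \<Longrightarrow> h = 0"
        define f' where "f' = form_of d y"
        have f': "f' \<in> binary_forms d"
          by (simp add: f'_def form_of_in_binary_forms)
        have coord: "form_coord d f' i = y i" if "i \<le> d" for i
          using that by (simp add: f'_def form_coord_form_of)
        then have ap: "apolar d (dual_coord d (form_coord d f')) r h \<longleftrightarrow> apolar d (dual_coord d y) r h" for r h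
          by (intro apolar_cong) (simp add: dual_coord_def)
        have "f' \<noteq> 0"
        proof
          assume "f' = 0"
          then have "dual_coord d (form_coord d f') = (\<lambda>i. 0)"
            by (auto simp: form_coord_def dual_coord_def)
          then have "apolar d (dual_coord d (form_coord d f')) (n + 1) 1"
            using n by (simp add: apolar_def pairing_def)
          then show False
            using ap y(2)[of 1] by simp
        qed
        moreover have "waring_rank d f' = d - n"
          using rank_iff_nonsqfree_locus(3)[OF f' \<open>f' \<noteq> 0\<close> n] y g(2,3)
          by (auto simp: ap nonsqfree_locus_def)
        ultimately have "form_class d f' \<in> T"
          using sub f' stratum by blast
        then have "mpoly_eval P (form_coord d f') = 0"
          using F P form_class_self[OF f' \<open>f' \<noteq> 0\<close>] by (auto simp: proj_zeros_def)
        then show "mpoly_eval P y = 0"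
          using mpoly_eval_cong[OF Ph, of "form_coord d f'" y] coord by simp
      qed (use n in auto)
    qed
    then have "\<forall>P\<in>F. \<forall>h\<in>p. mpoly_eval P (form_coord d h) = 0"
      using f(1) F(1) mpoly_eval_class by blast
    then show "p \<in> T"
      using f F(2) by (auto simp: proj_zeros_def proj_forms_iff)
  qed
qed

lemma UN_waring_stratum:
  "(\<Union>i\<in>I. waring_stratum d (h i)) =
     {form_class d f | f. f \<in> binary_forms d \<and> f \<noteq> 0 \<and> (\<exists>i\<in>I. int (waring_rank d f) = h i)}"
  by (auto simp: waring_stratum_def form_class_def)

lemma locus_classes_eq_strata:
  assumes n: "2 * n + 3 \<le> d"
  shows "(locus_classes d (n + 2) :: 'a::{alg_closed_field,field_char_0} poly poly set set) =
    (\<Union>i\<in>{1..int n + 1}. waring_stratum d i) \<union> (\<Union>i\<in>{0..int n}. waring_stratum d (int d - i))"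
proof -
  have low: "1 \<le> r \<and> r \<le> n + 1 \<longleftrightarrow> (\<exists>i\<in>{1..int n + 1}. int r = i)" for r
    by auto
  have high: "d - n \<le> r \<and> r \<le> d \<longleftrightarrow> (\<exists>i\<in>{0..int n}. int r = int d - i)" for r
    using n by (auto intro!: bexI[of _ "int d - int r"])
  have "(locus_classes d (n + 2) :: 'a poly poly set set) = {form_class d f | f. f \<in> binary_forms d \<and> f \<noteq> 0 \<and>
      ((\<exists>i\<in>{1..int n + 1}. int (waring_rank d f) = i) \<or> (\<exists>i\<in>{0..int n}. int (waring_rank d f) = int d - i))}"
       unfolding locus_classes_def low[symmetric] high[symmetric]
    by (intro Collect_cong ex_cong1 conj_cong refl) (rule rank_iff_nonsqfree_locus(1)[OF _ _ n])
  also have "\<dots> = (\<Union>i\<in>{1..int n + 1}. waring_stratum d i) \<union> (\<Union>i\<in>{0..int n}. waring_stratum d (int d - i))"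
    unfolding UN_waring_stratum by blast
  finally show ?thesis .
qed

lemma waring_strata_disjoint:
  fixes p :: "'a::{alg_closed_field,field_char_0} poly poly set"
  assumes "p \<in> waring_stratum d i" "p \<in> waring_stratum d j" "0 < d"
  shows "i = j"
proof -
  obtain f g where f: "p = form_class d f" "f \<in> binary_forms d" "f \<noteq> 0" "int (waring_rank d f) = i"
    and g: "p = form_class d g" "int (waring_rank d g) = j"
    using assms(1,2) by (auto simp: waring_stratum_def form_class_def)
  then have "(g, f) \<in> proportional d"
    using form_class_eq_iff by metis
  then show ?thesis
    using waring_rank_proportional[OF _ assms(3)] f g by metis
qed

theorem theorem1:
  fixes d :: nat and k :: int
  assumes "d > 0" and "int d \<ge> int d - k" and "int d - k > \<lceil>(real d + 1) / 2\<rceil>"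
  shows "zariski_topology d closure_of
             (waring_stratum d (int d - k) :: 'a::{alg_closed_field, field_char_0} poly poly set set) =
           (\<Union>i\<in>{1..k+1}. waring_stratum d i) \<union> (\<Union>i\<in>{0..k}. waring_stratum d (int d - i)) \<and>
         zariski_topology d closure_of
             (waring_stratum d (int d - k) :: 'a poly poly set set) -
           zariski_topology d closure_of (waring_stratum d (int d - k + 1)) =
           waring_stratum d (k + 1) \<union> waring_stratum d (int d - k)"
proof -
  obtain n where k: "k = int n"
    using assms(2) nonneg_int_cases[of k] by auto
  \<comment> \<open>An integer above the ceiling is at least \<open>(d + 1) / 2 + 1\<close>; for
    \<open>k = n\<close> this amounts to \<open>2 * n + 3 \<le> d\<close>.\<close>
  have "(real d + 1) / 2 \<le> real_of_int (int d - k) - 1"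
    using assms(3) by (simp add: ceiling_less_iff)
  then have "real (2 * n + 3) \<le> real d"
    by (simp add: k field_simps)
  then have n: "2 * n + 3 \<le> d"
    by (simp only: of_nat_le_iff)
  define S :: "int \<Rightarrow> 'a poly poly set set" where "S = waring_stratum d"
  have cl: "zariski_topology d closure_of S (int d - int m) =
      (\<Union>i\<in>{1..int m + 1}. S i) \<union> (\<Union>i\<in>{0..int m}. S (int d - i))" if "2 * m + 3 \<le> d" for m
    unfolding S_def closure_stratum[OF that] by (rule locus_classes_eq_strata[OF that])
  have disj: "i = j" if "p \<in> S i" "p \<in> S j" for p i j
    using waring_strata_disjoint that assms(1) unfolding S_def by blast
  have "zariski_topology d closure_of S (int d - k) - zariski_topology d closure_of S (int d - k + 1) =
      S (k + 1) \<union> S (int d - k)"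
  proof (cases n)
    case 0
    \<comment> \<open>Here the closure to be removed is that of the stratum of rank
      \<open>d + 1\<close>, which is empty.\<close>
    have "waring_rank d f \<le> d" if "f \<in> binary_forms d" "f \<noteq> 0" for f :: "'a poly poly"
      using rank_iff_nonsqfree_locus(2)[OF that n] .
    then have "S (int d + 1) = {}"
      by (force simp: S_def waring_stratum_def)
    then show ?thesis
      using cl[OF n] by (simp add: k 0)
  next
    case (Suc m)
    define B where "B = (\<Union>i\<in>{1..k}. S i) \<union> (\<Union>i\<in>{0..k - 1}. S (int d - i))"
    have "zariski_topology d closure_of S (int d - int m) = B"
      unfolding B_def using cl[of m] n by (simp add: k Suc add.commute)
    moreover have "int d - int m = int d - k + 1"
      by (simp add: k Suc)
    ultimately have lower: "zariski_topology d closure_of S (int d - k + 1) = B"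
      by simp
    have "{1..k + 1} = insert (k + 1) {1..k}" "{0..k} = insert k {0..k - 1}"
      using k by auto
    then have upper: "zariski_topology d closure_of S (int d - k) = S (k + 1) \<union> S (int d - k) \<union> B"
      unfolding k cl[OF n] B_def by (simp only: UN_insert Un_ac)
    \<comment> \<open>The ranks in \<open>B\<close> are \<open>1\<close> to \<open>k\<close> and
      \<open>d - k + 1\<close> to \<open>d\<close>. Since \<open>2 * k + 3 \<le> d\<close>, neither
      \<open>k + 1\<close> nor \<open>d - k\<close> is among them.\<close>
    have "p \<notin> B" if "p \<in> S (k + 1) \<union> S (int d - k)" for p
      using that n k unfolding B_def by (auto dest: disj)
    then show ?thesis
      unfolding lower upper by blast
  qed
  then show ?thesis
    using cl[OF n, folded k] unfolding S_def by (intro conjI)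
qed

end
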